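(* Let $R$ and $\tilde R$ be normal Noetherian domains, and let $(\mathcal C,R)$ and $(\tilde{\mathcal C},\tilde R)$ be cluster structures of geometric type in $R$ and $\tilde R$ with fixed initial extended seeds $(\mathbf x_0,B_0)$ and $(\tilde{\mathbf x}_0,\tilde B_0)$; let $N$ be the rank of $\mathcal C$. Assume the following: 1) there is a marker $\kappa$ that makes $(\mathcal C,\tilde{\mathcal C},\kappa)$ a related triple, along with a birational quasi-isomorphism $\mathcal Q:(\mathcal C,R)\to(\tilde{\mathcal C},\tilde R)$; 2) the matrices $B_0$ and $\tilde B_0$ are of full rank; 3) the inclusion $\bar{\mathcal A}(\tilde{\mathcal C})\supseteq\tilde R$ holds; 4) for each $i\in\mathcal I(\kappa)$, $\mathcal L(\mathbf x_i')\supseteq R$, where $\mathbf x_i'$ denotes the extended cluster obtained from $\mathbf x_0$ by mutation in direction $i\in[1,N]$. Then $\bar{\mathcal A}(\mathcal C)\supseteq R$.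
   Context: Rings are commutative with $1$; $[a,b]=\{a,a+1,\dots,b\}$. A domain is normal if it is integrally closed in its fraction field. Cluster structures. Let $\mathcal F$ be a field of rational functions in $N+M$ variables over $\mathbb Q$. An extended seed is a pair $\Sigma=(\mathbf x,B)$, where $\mathbf x=(x_1,\dots,x_{N+M})$ is a tuple of elements of $\mathcal F$ with $\mathcal F=\mathbb Q(x_1,\dots,x_{N+M})$ (the extended cluster), and $B=(b_{ij})$, $i\in[1,N]$, $j\in[1,N+M]$, is an integer matrix (the exchange matrix) whose first $N$ columns form a skew-symmetrizable matrix $B^{[1,N]}$ (there is a diagonal matrix $D$ with positive diagonal entries such that $DB^{[1,N]}$ is skew-symmetric). $x_1,\dots,x_N$ are cluster variables, $x_{N+1},\dots,x_{N+M}$ are frozen variables. The mutation of $\Sigma$ in direction $k\in[1,N]$ is the extended seed $((\mathbf x\setminus\{x_k\})\cup\{x_k'\},B')$ with $x_kx_k'=\prod_{b_{kj}>0}x_j^{b_{kj}}+\prod_{b_{kj}<0}x_j^{-b_{kj}}$, and $b'_{ij}=-b_{ij}$ if $i=k$ or $j=k$, $b'_{ij}=b_{ij}+\frac12(|b_{ik}|b_{kj}+b_{ik}|b_{kj}|)$ otherwise. The collection $\mathcal C$ of all extended seeds obtained from an initial extended seed $\Sigma_0=(\mathbf x_0,B_0)$ by finite sequences of mutations is a cluster structure of geometric type of rank $N$, with ambient field $\mathcal F=\mathcal F_{\mathcal C}$. For an extended cluster $\mathbf x$, $\mathcal A(\mathbf x)=\mathbb Z[x_1,\dots,x_{N+M}]$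 and $\mathcal L(\mathbf x)=\mathbb Z[x_1^{\pm1},\dots,x_N^{\pm1},x_{N+1},\dots,x_{N+M}]$. The upper cluster algebra is $\bar{\mathcal A}(\mathcal C)=\bigcap_{\mathbf x\in\mathcal C}\mathcal L(\mathbf x)$ (over all extended clusters of $\mathcal C$). A cluster structure in an integral domain $R$ is a cluster structure $\mathcal C$ with an embedding $\mathcal A(\mathbf x_0)\hookrightarrow\operatorname{Frac}R$; then $\mathcal F_{\mathcal C}$ is identified with a subfield of $\operatorname{Frac}R$. A variable is regular if it lies in $R$. Related triples. Let $\mathcal C$ (rank $N$, $M$ frozen variables) and $\tilde{\mathcal C}$ (rank $\tilde N$, $\tilde M$ frozen variables) be cluster structures with $\tilde N<N$, $N+M=\tilde N+\tilde M$, and fixed initial extended seeds $(\mathbf x_0,B_0)$, $(\tilde{\mathbf x}_0,\tilde B_0)$, $\mathbf x_0=(x_1,\dots,x_{N+M})$, $\tilde{\mathbf x}_0=(\tilde x_1,\dots,\tilde x_{N+M})$. A marker is a bijection $\kappa:[1,N+M]\to[1,N+M]$ with $\kappa([N+1,N+M])\subset[\tilde N+1,\tilde N+\tilde M]$; then $(\mathcal C,\tilde{\mathcal C},\kappa)$ is called a related triple. Put $\tilde{\mathcal I}(\kappa)=[\tilde N+1,\tilde N+\tilde M]\cap\kappa([1,N])$ and $\mathcal I(\kappa)=\kappa^{-1}(\tilde{\mathcal I}(\kappa))\subseteq[1,N]$. The marked variables are $\mathbf x_0(\kappa)=\{x_i\in\mathbf x_0: i\in\mathcal I(\kappa)\}$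 in $\mathcal C$ and $\tilde{\mathbf x}_0(\kappa)=\{\tilde x_i\in\tilde{\mathbf x}_0: i\in\tilde{\mathcal I}(\kappa)\}$ in $\tilde{\mathcal C}$. An extended seed (and its extended cluster) of $\mathcal C$ is marked if it is obtained from the initial one by mutations in directions $i_1,\dots,i_m\in[1,N]\setminus\mathcal I(\kappa)$; the extended seed of $\tilde{\mathcal C}$ obtained from the initial one by mutations in directions $\kappa(i_1),\dots,\kappa(i_m)$ is related to it. Quasi-isomorphisms. A quasi-isomorphism $\mathcal Q:\mathcal C\to\tilde{\mathcal C}$ is a field isomorphism $\mathcal Q:\mathcal F_{\mathcal C}\to\mathcal F_{\tilde{\mathcal C}}$ such that for every extended marked cluster $\mathbf x$ with related extended cluster $\tilde{\mathbf x}$ there are integers $\lambda_{ij}$ ($i\in[1,N+M]$, $j\in\mathcal I(\kappa)$) with $\mathcal Q(x_i)=\tilde x_{\kappa(i)}\prod_{j\in\mathcal I(\kappa)}\tilde x_{\kappa(j)}^{\lambda_{ij}}$ for $i\notin\mathcal I(\kappa)$ and $\mathcal Q(x_i)=\prod_{j\in\mathcal I(\kappa)}\tilde x_{\kappa(j)}^{\lambda_{ij}}$ for $i\in\mathcal I(\kappa)$. If $\mathcal C,\tilde{\mathcal C}$ are cluster structures in normal Noetherian domains $R,\tilde R$, then $\mathcal Q$ is birational if the marked variables $\mathbf x_0(\kappa)$, $\tilde{\mathbf x}_0(\kappa)$ are regular and the isomorphism $\mathcal Q:\mathcal A(\mathbf x_0)[\mathbf x_0(\kappa)^{\pm1}]\to\mathcal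 A(\tilde{\mathbf x}_0)[\tilde{\mathbf x}_0(\kappa)^{\pm1}]$ extends to a ring isomorphism $R[\mathbf x_0(\kappa)^{\pm1}]\to\tilde R[\tilde{\mathbf x}_0(\kappa)^{\pm1}]$ (i.e. there is such a ring isomorphism whose induced isomorphism of fraction fields restricts to $\mathcal Q$ on $\mathcal F_{\mathcal C}$), where $[\,\cdot^{\pm1}]$ denotes localization at all the listed elements. *)

theory Defs
  imports
    "HOL-Library.Poly_Mapping"
    "HOL-Computational_Algebra.Polynomial_Factorial"
    "HOL-Algebra.Algebra"
    "Jordan_Normal_Form.DL_Rank"
begin

text \<open>
  A domain \<open>R\<close> is a type of class \<^class>\<open>idom\<close>, and its fraction field is the type
  \<open>R fract\<close>. Subrings and subfields of a field \<open>K\<close> are sets of elements of \<open>K\<close>; where a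
  ring structure is needed, such a set \<open>A\<close> becomes the record \<open>subring_of A\<close>.
\<close>

section \<open>Rings\<close>

abbreviation subring_of :: "'k::field set \<Rightarrow> 'k ring" where
  "subring_of A \<equiv> class_ring\<lparr>carrier := A\<rparr>"

abbreviation noetherian_idom :: "'r::idom itself \<Rightarrow> bool" where
  "noetherian_idom _ \<equiv> noetherian_domain (class_ring :: 'r ring)"

text \<open>Integrally closed in its fraction field.\<close>

definition normal_idom :: "'r::idom itself \<Rightarrow> bool" where
  "normal_idom _ \<longleftrightarrow>
     (\<forall>y :: 'r fract. (\<exists>p :: 'r poly. lead_coeff p = 1 \<and> poly (map_poly to_fract p) y = 0)
        \<longrightarrow> y \<in> range (to_fract :: 'r \<Rightarrow> 'r fract))"

text \<open>The copy of \<open>R\<close> inside \<open>Frac R\<close>.\<close>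

definition base_ring :: "'r::idom fract set" where
  "base_ring = range to_fract"

text \<open>\<open>A[S\<^sup>\<plusminus>\<^sup>1]\<close> for a subring \<open>A\<close> and a set \<open>S\<close> of elements of \<open>A\<close>, formed inside the field.\<close>

definition localize :: "'k::field set \<Rightarrow> 'k set \<Rightarrow> 'k set" where
  "localize A S = generate_ring class_ring (A \<union> inverse ` S)"

text \<open>
  Polynomials over the integers in variables \<open>t\<^sub>i\<close> (\<open>i :: nat\<close>) are finitely supported maps
  from exponent vectors to coefficients.
\<close>

definition zpoly_eval :: "(nat \<Rightarrow> 'k::field) \<Rightarrow> ((nat \<Rightarrow>\<^sub>0 nat) \<Rightarrow>\<^sub>0 int) \<Rightarrow> 'k" where
  "zpoly_eval x p =
     (\<Sum>m\<in>Poly_Mapping.keys p. of_int (Poly_Mapping.lookup p m) *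
        (\<Prod>i\<in>Poly_Mapping.keys m. x i ^ Poly_Mapping.lookup m i))"

text \<open>
  Injectivity of \<open>t\<^sub>i \<mapsto> x\<^sub>i\<close> on integer polynomials in the \<open>t\<^sub>i\<close>, \<open>i \<in> I\<close>. In a field this is
  characteristic zero together with algebraic independence over the rationals, since constant
  polynomials are included and denominators can be cleared.
\<close>

definition alg_independent :: "nat set \<Rightarrow> (nat \<Rightarrow> 'k::field) \<Rightarrow> bool" where
  "alg_independent I x \<longleftrightarrow>
     (\<forall>p. (\<forall>m\<in>Poly_Mapping.keys p. Poly_Mapping.keys m \<subseteq> I) \<longrightarrow> zpoly_eval x p = 0 \<longrightarrow> p = 0)"

section \<open>Cluster structures of geometric type\<close>

text \<open>
  Tuples and matrices are indexed from 1 as in the usual notation: clusters by \<open>{1..N+M}\<close>,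
  exchange matrices by \<open>{1..N} \<times> {1..N+M}\<close>. Values outside these ranges play no role.
\<close>

type_synonym 'k seed = "(nat \<Rightarrow> 'k) \<times> (nat \<Rightarrow> nat \<Rightarrow> int)"

definition skew_symmetrizable :: "nat \<Rightarrow> (nat \<Rightarrow> nat \<Rightarrow> int) \<Rightarrow> bool" where
  "skew_symmetrizable N B \<longleftrightarrow>
     (\<exists>d :: nat \<Rightarrow> real. (\<forall>i\<in>{1..N}. d i > 0) \<and>
        (\<forall>i\<in>{1..N}. \<forall>j\<in>{1..N}. d i * of_int (B i j) = - (d j * of_int (B j i))))"

definition mutate_cluster ::
  "nat \<Rightarrow> nat \<Rightarrow> (nat \<Rightarrow> nat \<Rightarrow> int) \<Rightarrow> (nat \<Rightarrow> 'k::field) \<Rightarrow> (nat \<Rightarrow> 'k)" where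
  "mutate_cluster n k B x =
     x(k := ((\<Prod>j\<in>{j\<in>{1..n}. B k j > 0}. x j ^ nat (B k j)) +
             (\<Prod>j\<in>{j\<in>{1..n}. B k j < 0}. x j ^ nat (- B k j))) / x k)"

text \<open>The numerator of the \<open>div\<close> below is always even, so the division is exact.\<close>

definition mutate_matrix :: "nat \<Rightarrow> (nat \<Rightarrow> nat \<Rightarrow> int) \<Rightarrow> (nat \<Rightarrow> nat \<Rightarrow> int)" where
  "mutate_matrix k B = (\<lambda>i j.
     if i = k \<or> j = k then - B i j
     else B i j + (\<bar>B i k\<bar> * B k j + B i k * \<bar>B k j\<bar>) div 2)"

definition mutate :: "nat \<Rightarrow> nat \<Rightarrow> 'k::field seed \<Rightarrow> 'k seed" where
  "mutate n k s = (mutate_cluster n k (snd s) (fst s), mutate_matrix k (snd s))"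

text \<open>A cluster structure is given by its rank, number of frozen variables and initial seed.\<close>

record 'k cluster_data =
  rk :: nat
  frozen :: nat
  cluster0 :: "nat \<Rightarrow> 'k"
  matrix0 :: "nat \<Rightarrow> nat \<Rightarrow> int"

definition nvars :: "'k cluster_data \<Rightarrow> nat" where
  "nvars C = rk C + frozen C"

text \<open>
  A cluster structure realised inside the field \<open>K\<close>: the initial extended cluster consists of
  independent variables, so that \<open>\<int>[x\<^sub>1, \<dots>, x\<^sub>N\<^sub>+\<^sub>M]\<close> is a polynomial ring embedded in \<open>K\<close>. With
  \<open>K = R fract\<close>, this is a cluster structure in the domain \<open>R\<close>, its ambient field being
  identified with the subfield \<open>ambient_field C\<close> of \<open>R fract\<close>.
\<close>

definition cluster_structure :: "'k::field cluster_data \<Rightarrow> bool" where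
  "cluster_structure C \<longleftrightarrow>
     alg_independent {1..nvars C} (cluster0 C) \<and> skew_symmetrizable (rk C) (matrix0 C)"

definition ambient_field :: "'k::field cluster_data \<Rightarrow> 'k set" where
  "ambient_field C = generate_field class_ring (cluster0 C ` {1..nvars C})"

text \<open>The seed obtained from the initial one by mutating in the directions \<open>ks\<close>, leftmost first.\<close>

definition seed_along :: "'k::field cluster_data \<Rightarrow> nat list \<Rightarrow> 'k seed" where
  "seed_along C ks = fold (mutate (nvars C)) ks (cluster0 C, matrix0 C)"

definition cluster_along :: "'k::field cluster_data \<Rightarrow> nat list \<Rightarrow> nat \<Rightarrow> 'k" where
  "cluster_along C ks = fst (seed_along C ks)"

definition seeds :: "'k::field cluster_data \<Rightarrow> 'k seed set" where
  "seeds C = {seed_along C ks | ks. set ks \<subseteq> {1..rk C}}"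

definition laurent_ring :: "'k::field cluster_data \<Rightarrow> (nat \<Rightarrow> 'k) \<Rightarrow> 'k set" where
  "laurent_ring C x =
     generate_ring class_ring (x ` {1..nvars C} \<union> (\<lambda>i. inverse (x i)) ` {1..rk C})"

definition upper_cluster_algebra :: "'k::field cluster_data \<Rightarrow> 'k set" where
  "upper_cluster_algebra C = (\<Inter>(x, B)\<in>seeds C. laurent_ring C x)"

text \<open>
  The library's \<open>rank\<close> takes the number of rows as locale parameter; JNF matrices are indexed
  from 0. The matrix has \<open>rk C\<close> rows and at least as many columns.
\<close>

definition exchange_matrix :: "'k cluster_data \<Rightarrow> rat mat" where
  "exchange_matrix C = mat (rk C) (nvars C) (\<lambda>(i, j). of_int (matrix0 C (Suc i) (Suc j)))"

definition full_rank :: "'k cluster_data \<Rightarrow> bool" where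
  "full_rank C \<longleftrightarrow> vec_space.rank (rk C) (exchange_matrix C) = rk C"

section \<open>Related triples and quasi-isomorphisms\<close>

definition related_triple ::
  "'k cluster_data \<Rightarrow> 'l cluster_data \<Rightarrow> (nat \<Rightarrow> nat) \<Rightarrow> bool" where
  "related_triple C C' \<kappa> \<longleftrightarrow>
     rk C' < rk C \<and> nvars C = nvars C' \<and>
     bij_betw \<kappa> {1..nvars C} {1..nvars C} \<and>
     \<kappa> ` {rk C + 1..nvars C} \<subseteq> {rk C' + 1..nvars C'}"

definition marked_target :: "'k cluster_data \<Rightarrow> 'l cluster_data \<Rightarrow> (nat \<Rightarrow> nat) \<Rightarrow> nat set" where
  "marked_target C C' \<kappa> = {rk C' + 1..nvars C'} \<inter> \<kappa> ` {1..rk C}"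

definition marked_source :: "'k cluster_data \<Rightarrow> 'l cluster_data \<Rightarrow> (nat \<Rightarrow> nat) \<Rightarrow> nat set" where
  "marked_source C C' \<kappa> = {i \<in> {1..nvars C}. \<kappa> i \<in> marked_target C C' \<kappa>}"

definition quasi_isomorphism ::
  "'k::field cluster_data \<Rightarrow> 'l::field cluster_data \<Rightarrow> (nat \<Rightarrow> nat) \<Rightarrow> ('k \<Rightarrow> 'l) \<Rightarrow> bool" where
  "quasi_isomorphism C C' \<kappa> Q \<longleftrightarrow>
     Q \<in> ring_iso (subring_of (ambient_field C)) (subring_of (ambient_field C')) \<and>
     (let I = marked_source C C' \<kappa> in
      \<forall>ks. set ks \<subseteq> {1..rk C} - I \<longrightarrow>
        (let x = cluster_along C ks; x' = cluster_along C' (map \<kappa> ks) in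
         \<exists>l :: nat \<Rightarrow> nat \<Rightarrow> int.
           (\<forall>i\<in>{1..nvars C} - I. Q (x i) = x' (\<kappa> i) * (\<Prod>j\<in>I. x' (\<kappa> j) powi l i j)) \<and>
           (\<forall>i\<in>I. Q (x i) = (\<Prod>j\<in>I. x' (\<kappa> j) powi l i j))))"

text \<open>
  \<open>\<psi>\<close> is the isomorphism of localized rings, \<open>\<Psi>\<close> the isomorphism it induces on fraction fields
  (the fraction field of either localization is the whole type).
\<close>

definition birational ::
  "'r::idom fract cluster_data \<Rightarrow> 's::idom fract cluster_data \<Rightarrow> (nat \<Rightarrow> nat) \<Rightarrow>
     ('r fract \<Rightarrow> 's fract) \<Rightarrow> bool" where
  "birational C C' \<kappa> Q \<longleftrightarrow>
     (let S = cluster0 C ` marked_source C C' \<kappa>; S' = cluster0 C' ` marked_target C C' \<kappa> in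
      S \<subseteq> base_ring \<and> S' \<subseteq> base_ring \<and>
      (\<exists>\<psi> \<in> ring_iso (subring_of (localize base_ring S)) (subring_of (localize base_ring S')).
       \<exists>\<Psi> \<in> ring_iso (class_ring :: 'r fract ring) (class_ring :: 's fract ring).
         (\<forall>a \<in> localize base_ring S. \<Psi> a = \<psi> a) \<and>
         (\<forall>f \<in> ambient_field C. \<Psi> f = Q f)))"

end

theory Submission
  imports Defs "HOL-Library.Function_Algebras"
begin

text \<open>
  The full rank condition makes the upper bound \<open>L(x) \<inter> \<Inter>\<^sub>k L(\<mu>\<^sub>k x)\<close> of a seed invariant under
  mutation, so it suffices to put \<open>R\<close> into \<open>L(x\<^sub>0)\<close> and into \<open>L(\<mu>\<^sub>k x\<^sub>0)\<close> for all \<open>k\<close>. For unmarked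
  \<open>k\<close> (and for \<open>x\<^sub>0\<close>) this is pulled back along the quasi-isomorphism: it identifies \<open>L(x)\<close> with the
  localization of \<open>L\<close> of the related cluster at the marked variables, which contains the image of \<open>R\<close>.
  For marked \<open>k\<close> it is a hypothesis.

  Invariance is first shown with the frozen variables inverted. Let \<open>A\<close> be the full Laurent ring of
  \<open>\<mu>\<^sub>j \<mu>\<^sub>k x\<close>. An element of the full Laurent rings of \<open>x\<close>, \<open>\<mu>\<^sub>k x\<close> and \<open>\<mu>\<^sub>j x\<close> lands in \<open>A\<close> after
  multiplication by a power of \<open>x\<^sub>k\<close>, and also after multiplication by a power of \<open>x\<^sub>j\<close>; and
  \<open>x\<^sub>k\<close>, \<open>x\<^sub>j\<close> are coprime in \<open>A\<close>. If \<open>b\<^sub>k\<^sub>j \<noteq> 0\<close> they even generate the unit ideal, by the exchange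
  relation; otherwise they are, up to units, binomials \<open>1 + y\<^sup>u\<close> and \<open>1 + y\<^sup>v\<close> with independent
  exponents. The poles along frozen variables are excluded afterwards, one mutation at a time, because
  exchange binomials are not divisible by frozen variables.
\<close>

text \<open>The coprimality argument needs monomials to be units, so it runs with every frozen
  variable inverted, while the claim keeps them polynomial. Hence the invariant is asymmetric:
  frozen variables stay uninverted at the current cluster only, and are inverted at its neighbours.
  When a neighbour becomes the current cluster, the sharper membership is regained from the exchange
  binomial. That a power of \<open>x k\<close> alone brings an element into A rests on a splitting:
  an element of the full Laurent rings of \<open>x\<close> and of its mutation at \<open>j\<close>
  is a polynomial in \<open>x j\<close> plus a polynomial in the new variable, the other variables
  being inverted. Both of these variables lie in A. In the transport, a quasi-isomorphism only says
  that marked variables go to monomials in marked variables; invertibility of the exponent matrix is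
  not part of the notion. Surjectivity on the ambient fields is what makes target marked variables
  images of units. Laurent polynomials are treated as field elements with an expansion over a
  prescribed set of exponents, so divisibility becomes a question about finite supports in a
  lattice.\<close>

lemma subring_class_ringI:
  assumes "1 \<in> A" "\<And>a. a \<in> A \<Longrightarrow> - a \<in> A"
    and "\<And>a b. a \<in> A \<Longrightarrow> b \<in> A \<Longrightarrow> a * b \<in> A" "\<And>a b. a \<in> A \<Longrightarrow> b \<in> A \<Longrightarrow> a + b \<in> A"
  shows "subring A (class_ring :: 'k::field ring)"
  using ring.subringI[OF class_ring.ring_axioms, of A] assms by (simp add: class_ring_simps)

lemma subring_class_ringD:
  assumes "subring A (class_ring :: 'k::field ring)"
  shows "1 \<in> A" "0 \<in> A" "a \<in> A \<Longrightarrow> - a \<in> A"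
    and "a \<in> A \<Longrightarrow> b \<in> A \<Longrightarrow> a * b \<in> A" "a \<in> A \<Longrightarrow> b \<in> A \<Longrightarrow> a + b \<in> A"
    and "a \<in> A \<Longrightarrow> b \<in> A \<Longrightarrow> a - b \<in> A"
proof -
  note E = subringE[OF assms, simplified class_ring_simps, simplified]
  show "1 \<in> A" "0 \<in> A" "a \<in> A \<Longrightarrow> - a \<in> A"
    "a \<in> A \<Longrightarrow> b \<in> A \<Longrightarrow> a * b \<in> A" "a \<in> A \<Longrightarrow> b \<in> A \<Longrightarrow> a + b \<in> A"
    using E by auto
  then show "a \<in> A \<Longrightarrow> b \<in> A \<Longrightarrow> a - b \<in> A"
    using E(7)[of a "- b"] E(5)[of b] by simp
qed

lemma subring_power:
  "subring A (class_ring :: 'k::field ring) \<Longrightarrow> a \<in> A \<Longrightarrow> a ^ m \<in> A"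
  by (induction m) (auto simp: subring_class_ringD)

lemma subring_powi:
  "subring A (class_ring :: 'k::field ring) \<Longrightarrow> a \<in> A \<Longrightarrow> inverse a \<in> A \<Longrightarrow> a powi m \<in> A"
  by (auto simp: power_int_def subring_power)

lemma subring_prod:
  assumes "subring A (class_ring :: 'k::field ring)" "\<And>i. i \<in> I \<Longrightarrow> f i \<in> A"
  shows "prod f I \<in> A"
  using assms(2) by (induction I rule: infinite_finite_induct) (auto simp: subring_class_ringD[OF assms(1)])

lemma subring_of_int:
  assumes "subring A (class_ring :: 'k::field ring)"
  shows "of_int m \<in> A"
proof -
  have "of_nat j \<in> A" for j
    by (induction j) (auto simp: subring_class_ringD[OF assms])
  then show ?thesis
    by (cases m) (use subring_class_ringD[OF assms] in \<open>auto simp del: of_nat_Suc\<close>)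
qed

lemma generate_ring_subring: "subring (generate_ring class_ring H) (class_ring :: 'k::field ring)"
  by (rule ring.generate_ring_is_subring[OF class_ring.ring_axioms]) simp

lemma generate_ring_least:
  "subring A (class_ring :: 'k::field ring) \<Longrightarrow> H \<subseteq> A \<Longrightarrow> generate_ring class_ring H \<subseteq> A"
  by (rule ring.generate_ring_min_subring1[OF class_ring.ring_axioms]) auto

section \<open>Laurent monomials\<close>

text \<open>Exponents vanish outside \<open>{1..n}\<close>, so that distinct exponents are distinct monomials.\<close>

definition expo :: "nat \<Rightarrow> (nat \<Rightarrow> int) set" where
  "expo n = {w. \<forall>i. i \<notin> {1..n} \<longrightarrow> w i = 0}"

definition mon :: "nat \<Rightarrow> (nat \<Rightarrow> 'k::field) \<Rightarrow> (nat \<Rightarrow> int) \<Rightarrow> 'k" where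
  "mon n x w = (\<Prod>i\<in>{1..n}. x i powi w i)"

definition lev :: "nat \<Rightarrow> (nat \<Rightarrow> 'k::field) \<Rightarrow> ((nat \<Rightarrow> int) \<Rightarrow> int) \<Rightarrow> 'k" where
  "lev n x c = (\<Sum>w | c w \<noteq> 0. of_int (c w) * mon n x w)"

text \<open>Every pole condition goes into the set \<open>W\<close> of allowed exponents:
  half-spaces express polynomial behaviour in one variable, slices express a grading.\<close>

definition monspan :: "nat \<Rightarrow> (nat \<Rightarrow> 'k::field) \<Rightarrow> (nat \<Rightarrow> int) set \<Rightarrow> 'k set" where
  "monspan n x W = {lev n x c | c. finite {w. c w \<noteq> 0} \<and> {w. c w \<noteq> 0} \<subseteq> W}"

text \<open>Algebraic independence, restated for Laurent polynomials so that it can be carried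
  across an exchange, where negative exponents are unavoidable. Finite support is demanded
  explicitly, since \<open>lev\<close> evaluates to 0 on an infinite support.\<close>

definition indep :: "nat \<Rightarrow> (nat \<Rightarrow> 'k::field) \<Rightarrow> bool" where
  "indep n x \<longleftrightarrow> (\<forall>i\<in>{1..n}. x i \<noteq> 0) \<and>
     (\<forall>c. finite {w. c w \<noteq> 0} \<longrightarrow> {w. c w \<noteq> 0} \<subseteq> expo n \<longrightarrow> lev n x c = 0 \<longrightarrow> c = 0)"

lemma indep_nonzero: "indep n x \<Longrightarrow> \<forall>i\<in>{1..n}. x i \<noteq> 0"
  by (simp add: indep_def)

lemma indep_levD:
  assumes "indep n x" "finite {w. c w \<noteq> 0}" "{w. c w \<noteq> 0} \<subseteq> expo n" "lev n x c = 0"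
  shows "c w = 0"
proof -
  have "c = 0" by (rule assms(1)[unfolded indep_def, THEN conjunct2, rule_format, OF assms(2-)])
  then show ?thesis by simp
qed

lemma expo_closed [simp]:
  "u \<in> expo n \<Longrightarrow> v \<in> expo n \<Longrightarrow> u + v \<in> expo n"
  "u \<in> expo n \<Longrightarrow> v \<in> expo n \<Longrightarrow> u - v \<in> expo n"
  "0 \<in> expo n"  "u \<in> expo n \<Longrightarrow> - u \<in> expo n"
  "u \<in> expo n \<Longrightarrow> (\<lambda>i. a * u i) \<in> expo n"
  by (auto simp: expo_def)

lemma expo_eqI: "u \<in> expo n \<Longrightarrow> v \<in> expo n \<Longrightarrow> (\<And>i. i \<in> {1..n} \<Longrightarrow> u i = v i) \<Longrightarrow> u = v"
  by (rule ext) (metis (mono_tags, lifting) expo_def mem_Collect_eq)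

lemma mon_zero [simp]: "mon n x 0 = 1"
  by (simp add: mon_def)

lemma mon_cong: "(\<And>i. i \<in> {1..n} \<Longrightarrow> w i \<noteq> 0 \<Longrightarrow> x i = y i) \<Longrightarrow> mon n x w = mon n y w"
  unfolding mon_def by (rule prod.cong) (auto, metis power_int_0_right)

lemma support_shift:
  fixes c :: "(nat \<Rightarrow> int) \<Rightarrow> int"
  shows "{w. c (w - u) \<noteq> 0} = (\<lambda>w. w + u) ` {w. c w \<noteq> 0}"
proof (intro equalityI subsetI)
  fix w assume "w \<in> {w. c (w - u) \<noteq> 0}"
  then show "w \<in> (\<lambda>w. w + u) ` {w. c w \<noteq> 0}"
    by (intro image_eqI[where x = "w - u"]) simp_all
qed auto

context
  fixes n :: nat and x :: "nat \<Rightarrow> 'k::field"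
  assumes nz: "\<forall>i\<in>{1..n}. x i \<noteq> 0"
begin

lemma mon_nonzero [simp]: "mon n x w \<noteq> 0"
  using nz by (auto simp: mon_def)

lemma mon_add: "mon n x (u + v) = mon n x u * mon n x v"
  unfolding mon_def prod.distrib[symmetric]
  by (rule prod.cong) (use nz in \<open>auto simp: power_int_add\<close>)

lemma mon_minus: "mon n x (- u) = inverse (mon n x u)"
  using mon_add[of u "- u"] by (simp add: inverse_eq_divide eq_divide_eq mult.commute)

lemma mon_diff: "mon n x (u - v) = mon n x u / mon n x v"
  using mon_add[of u "- v"] mon_minus[of v] by (simp add: field_simps)

lemma mon_scale: "mon n x (\<lambda>i. int a * u i) = mon n x u ^ a"
proof (induction a)
  case 0
  have "(\<lambda>i. int 0 * u i) = 0" by (simp add: fun_eq_iff)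
  then show ?case by (simp only: mon_zero power_0)
next
  case (Suc a)
  have "(\<lambda>i. int (Suc a) * u i) = u + (\<lambda>i. int a * u i)" by (simp add: fun_eq_iff algebra_simps)
  then show ?case by (simp only: mon_add Suc power_Suc)
qed

lemma mon_unit: "i \<in> {1..n} \<Longrightarrow> mon n x (\<lambda>j. if j = i then a else 0) = x i powi a"
proof -
  assume i: "i \<in> {1..n}"
  have "mon n x (\<lambda>j. if j = i then a else 0) = (\<Prod>j\<in>{1..n}. if j = i then x i powi a else 1)"
    unfolding mon_def by (rule prod.cong) auto
  then show ?thesis using i by simp
qed

lemma mon_shift: 
  assumes "finite {w. c w \<noteq> 0}"
  shows "lev n x (\<lambda>w. c (w - u)) = mon n x u * lev n x c"
proof -
  have "{w. c (w - u) \<noteq> 0} = (\<lambda>w. w + u) ` {w. c w \<noteq> 0}"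
    by (rule support_shift)
  then have "lev n x (\<lambda>w. c (w - u)) = (\<Sum>w | c w \<noteq> 0. of_int (c (w + u - u)) * mon n x (w + u))"
    unfolding lev_def by (simp add: sum.reindex inj_on_def)
  also have "\<dots> = (\<Sum>w | c w \<noteq> 0. of_int (c w) * mon n x (w + u))" by simp
  also have "\<dots> = mon n x u * lev n x c"
    by (simp add: lev_def sum_distrib_left mon_add mult_ac)
  finally show ?thesis .
qed

end

lemma lev_superset:
  assumes "finite S" "{w. c w \<noteq> 0} \<subseteq> S"
  shows "lev n x c = (\<Sum>w\<in>S. of_int (c w) * mon n x w)"
  unfolding lev_def by (rule sum.mono_neutral_left) (use assms in auto)

lemma support_add:
  fixes c d :: "'a \<Rightarrow> int"
  shows "{w. c w + d w \<noteq> 0} \<subseteq> {w. c w \<noteq> 0} \<union> {w. d w \<noteq> 0}"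
  by auto

lemma finite_support_add:
  fixes c d :: "'a \<Rightarrow> int"
  assumes "finite {w. c w \<noteq> 0}" "finite {w. d w \<noteq> 0}"
  shows "finite {w. c w + d w \<noteq> 0}"
  by (rule finite_subset[OF support_add finite_UnI[OF assms]])

lemma finite_support_shift:
  fixes c :: "(nat \<Rightarrow> int) \<Rightarrow> int"
  assumes "finite {w. c w \<noteq> 0}"
  shows "finite {w. c (w - u) \<noteq> 0}"
proof -
  show ?thesis unfolding support_shift using assms by (rule finite_imageI)
qed

lemma lev_add:
  assumes "finite {w. c w \<noteq> 0}" "finite {w. d w \<noteq> 0}"
  shows "lev n x (\<lambda>w. c w + d w) = lev n x c + lev n x d"
proof -
  define S where "S = {w. c w \<noteq> 0} \<union> {w. d w \<noteq> 0}"
  have S: "finite S" "{w. c w \<noteq> 0} \<subseteq> S" "{w. d w \<noteq> 0} \<subseteq> S" "{w. c w + d w \<noteq> 0} \<subseteq> S"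
    unfolding S_def using assms support_add by (simp_all only: finite_Un simp_thms Un_upper1 Un_upper2)
  show ?thesis
    unfolding lev_superset[OF S(1,2)] lev_superset[OF S(1,3)] lev_superset[OF S(1,4)]
    by (simp only: sum.distrib[symmetric] distrib_right of_int_add)
qed

lemma lev_minus: "lev n x (\<lambda>w. - c w) = - lev n x c"
  by (simp add: lev_def sum_negf)

lemma monspan_mono: "W \<subseteq> W' \<Longrightarrow> monspan n x W \<subseteq> monspan n x W'"
  unfolding monspan_def by auto

lemma monspan_zero: "0 \<in> monspan n x W"
proof -
  have "0 = lev n x (\<lambda>w. 0)" by (simp add: lev_def)
  then show ?thesis unfolding monspan_def by (intro CollectI exI[of _ "\<lambda>w. 0"]) auto
qed

lemma monspan_add: "f \<in> monspan n x W \<Longrightarrow> g \<in> monspan n x W \<Longrightarrow> f + g \<in> monspan n x W"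
proof -
  assume "f \<in> monspan n x W" "g \<in> monspan n x W"
  then obtain c d where c: "finite {w. c w \<noteq> 0}" "{w. c w \<noteq> 0} \<subseteq> W" "f = lev n x c"
    and d: "finite {w. d w \<noteq> 0}" "{w. d w \<noteq> 0} \<subseteq> W" "g = lev n x d"
    unfolding monspan_def by auto
  have "{w. c w + d w \<noteq> 0} \<subseteq> W"
    using c d by (smt (verit) Collect_mono_iff mem_Collect_eq subset_eq)
  then show ?thesis
    unfolding monspan_def c d using c d lev_add finite_support_add
    by (intro CollectI exI[of _ "\<lambda>w. c w + d w"]) (auto simp: lev_add)
qed

lemma monspan_minus: "f \<in> monspan n x W \<Longrightarrow> - f \<in> monspan n x W"
proof -
  assume "f \<in> monspan n x W"
  then obtain c where "finite {w. c w \<noteq> 0}" "{w. c w \<noteq> 0} \<subseteq> W" "f = lev n x c"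
    unfolding monspan_def by auto
  then show ?thesis unfolding monspan_def
    by (intro CollectI exI[of _ "\<lambda>w. - c w"]) (simp add: lev_minus)
qed

lemma monspan_diff: "f \<in> monspan n x W \<Longrightarrow> g \<in> monspan n x W \<Longrightarrow> f - g \<in> monspan n x W"
  using monspan_add[of f n x W "- g"] monspan_minus[of g n x W] by simp

lemma monspan_scaled_mon: "w \<in> W \<Longrightarrow> of_int a * mon n x w \<in> monspan n x W"
proof -
  assume w: "w \<in> W"
  let ?c = "\<lambda>v. if v = w then a else 0"
  have "of_int a * mon n x w = lev n x ?c"
    by (subst lev_superset[of "{w}"]) auto
  then show ?thesis unfolding monspan_def using w
    by (intro CollectI exI[of _ ?c]) auto
qed

lemma monspan_mon: "w \<in> W \<Longrightarrow> mon n x w \<in> monspan n x W"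
  using monspan_scaled_mon[of w W 1] by simp

lemma monspan_sum: "(\<And>i. i \<in> I \<Longrightarrow> f i \<in> monspan n x W) \<Longrightarrow> sum f I \<in> monspan n x W"
  by (induction I rule: infinite_finite_induct) (auto simp: monspan_zero monspan_add)

lemma monspan_induct [consumes 1, case_names zero mon add]:
  assumes "f \<in> monspan n x W" and "P 0"
    and "\<And>a w. w \<in> W \<Longrightarrow> P (of_int a * mon n x w)"
    and "\<And>f g. P f \<Longrightarrow> P g \<Longrightarrow> P (f + g)"
  shows "P f"
proof -
  obtain c where c: "finite {w. c w \<noteq> 0}" "{w. c w \<noteq> 0} \<subseteq> W" and f: "f = lev n x c"
    using assms(1) unfolding monspan_def by auto
  have "P (\<Sum>w\<in>S. of_int (c w) * mon n x w)" if "finite S" "S \<subseteq> W" for S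
    using that by (induction S) (use assms in auto)
  then show ?thesis using c unfolding f lev_def by blast
qed

lemma monspan_subset_subring:
  assumes "subring A (class_ring :: 'k::field ring)" "\<And>w. w \<in> W \<Longrightarrow> mon n x w \<in> A"
  shows "monspan n x W \<subseteq> A"
proof
  fix f assume "f \<in> monspan n x W"
  then show "f \<in> A"
    by (induction rule: monspan_induct)
      (use assms in \<open>auto intro: subring_class_ringD subring_of_int\<close>)
qed

lemma monspan_mult:
  assumes "\<forall>i\<in>{1..n}. x i \<noteq> 0" "f \<in> monspan n x U" "g \<in> monspan n x V"
    and "\<And>u v. u \<in> U \<Longrightarrow> v \<in> V \<Longrightarrow> u + v \<in> W"
  shows "f * g \<in> monspan n x W"
  using assms(2)
proof (induction rule: monspan_induct)
  case (mon a u)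
  note u = mon
  show ?case using assms(3)
  proof (induction rule: monspan_induct)
    case (mon b v)
    have "of_int a * mon n x u * (of_int b * mon n x v) = of_int (a * b) * mon n x (u + v)"
      by (simp add: mon_add[OF assms(1)])
    then show ?case using assms(4) u mon monspan_scaled_mon by metis
  qed (auto simp: monspan_zero monspan_add distrib_left)
qed (auto simp: monspan_zero monspan_add distrib_right)

text \<open>Two coefficient functions for \<open>f\<close> agree, so their common support lies in
  both \<open>U\<close> and \<open>V\<close>. This is the tool that separates the degrees in a
  single variable.\<close>

lemma indep_monspan_disjoint:
  assumes x: "indep n x" and f: "f \<in> monspan n x U" "f \<in> monspan n x V"
    and UV: "U \<subseteq> expo n" "V \<subseteq> expo n" "U \<inter> V = {}"
  shows "f = 0"
proof -
  obtain c d where c: "finite {w. c w \<noteq> 0}" "{w. c w \<noteq> 0} \<subseteq> U" "f = lev n x c"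
    and d: "finite {w. d w \<noteq> 0}" "{w. d w \<noteq> 0} \<subseteq> V" "f = lev n x d"
    using f unfolding monspan_def by auto
  let ?e = "\<lambda>w. c w + - d w"
  have d': "finite {w. - d w \<noteq> 0}" using d by simp
  have 0: "lev n x ?e = 0"
    using lev_add[OF c(1) d', of n x] c d by (simp add: lev_minus)
  have 1: "finite {w. ?e w \<noteq> 0}" by (rule finite_support_add[OF c(1) d'])
  have 2: "{w. ?e w \<noteq> 0} \<subseteq> expo n" using c d UV
    by (smt (verit) Collect_mono_iff mem_Collect_eq subset_eq)
  have cd: "c w = d w" for w using indep_levD[OF x 1 2 0, of w] by simp
  have "c w = 0" for w
  proof (rule ccontr)
    assume "c w \<noteq> 0"
    then have "w \<in> U" "w \<in> V" using c(2) d(2) cd[of w] by auto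
    then show False using UV(3) by auto
  qed
  then show ?thesis using c(3) by (simp add: lev_def)
qed

lemma indep_lev_unique:
  assumes "indep n x" "finite {w. c w \<noteq> 0}" "finite {w. d w \<noteq> 0}"
    "{w. c w \<noteq> 0} \<subseteq> expo n" "{w. d w \<noteq> 0} \<subseteq> expo n" "lev n x c = lev n x d"
  shows "c w = d w"
proof -
  let ?e = "\<lambda>w. c w + - d w"
  have d': "finite {w. - d w \<noteq> 0}" using assms by simp
  have 0: "lev n x ?e = 0"
    using lev_add[OF assms(2) d', of n x] assms by (simp add: lev_minus)
  have 1: "finite {w. ?e w \<noteq> 0}" by (rule finite_support_add[OF assms(2) d'])
  have 2: "{w. ?e w \<noteq> 0} \<subseteq> expo n" using assms
    by (smt (verit) Collect_mono_iff mem_Collect_eq subset_eq)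
  have "?e w = 0" by (rule indep_levD[OF assms(1) 1 2 0])
  then show ?thesis by simp
qed

section \<open>Laurent rings\<close>

definition laurent :: "nat \<Rightarrow> nat \<Rightarrow> (nat \<Rightarrow> 'k::field) \<Rightarrow> 'k set" where
  "laurent N n x = generate_ring class_ring (x ` {1..n} \<union> (\<lambda>i. inverse (x i)) ` {1..N})"

lemma laurent_subring: "subring (laurent N n x) class_ring"
  unfolding laurent_def by (rule generate_ring_subring)

lemmas laurent_closed = subring_class_ringD[OF laurent_subring]

lemma laurent_gens:
  "i \<in> {1..n} \<Longrightarrow> x i \<in> laurent N n x" "i \<in> {1..N} \<Longrightarrow> inverse (x i) \<in> laurent N n x"
  unfolding laurent_def by (auto intro: generate_ring.incl)

lemma laurent_least:
  assumes "subring A class_ring" "\<And>i. i \<in> {1..n} \<Longrightarrow> x i \<in> A"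
    "\<And>i. i \<in> {1..N} \<Longrightarrow> inverse (x i) \<in> A"
  shows "laurent N n x \<subseteq> A"
  unfolding laurent_def by (rule generate_ring_least) (use assms in auto)

lemma mon_in_subring:
  assumes "subring A (class_ring :: 'k::field ring)"
    and "\<And>i. i \<in> {1..n} \<Longrightarrow> 0 < w i \<Longrightarrow> x i \<in> A" "\<And>i. i \<in> {1..n} \<Longrightarrow> w i < 0 \<Longrightarrow> inverse (x i) \<in> A"
  shows "mon n x w \<in> A"
  unfolding mon_def
proof (rule subring_prod[OF assms(1)])
  fix i assume i: "i \<in> {1..n}"
  show "x i powi w i \<in> A"
  proof (cases "w i" "0::int" rule: linorder_cases)
    case less
    then show ?thesis using assms(3)[OF i] subring_power[OF assms(1)] by (simp add: power_int_def)
  next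
    case greater
    then show ?thesis using assms(2)[OF i] subring_power[OF assms(1)] by (simp add: power_int_def)
  qed (simp add: subring_class_ringD[OF assms(1)])
qed

lemma laurent_eq_monspan:
  assumes nz: "\<forall>i\<in>{1..n}. x i \<noteq> 0" and "N \<le> n"
  shows "laurent N n x = monspan n x {w \<in> expo n. \<forall>i\<in>{N+1..n}. 0 \<le> w i}" (is "_ = monspan n x ?W")
proof
  have "subring (monspan n x ?W) class_ring"
  proof (rule subring_class_ringI)
    have "mon n x 0 \<in> monspan n x ?W" by (rule monspan_mon) auto
    then show "1 \<in> monspan n x ?W" by simp
    show "a * b \<in> monspan n x ?W" if "a \<in> monspan n x ?W" "b \<in> monspan n x ?W" for a b
      by (rule monspan_mult[OF nz that]) auto
  qed (auto simp: monspan_add monspan_minus)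
  moreover have "x i \<in> monspan n x ?W" if "i \<in> {1..n}" for i
  proof -
    have "mon n x (\<lambda>j. if j = i then 1 else 0) \<in> monspan n x ?W"
      by (rule monspan_mon) (use that in \<open>auto simp: expo_def\<close>)
    then show ?thesis using mon_unit[OF nz that, of 1] by simp
  qed
  moreover have "inverse (x i) \<in> monspan n x ?W" if "i \<in> {1..N}" for i
  proof -
    have "mon n x (\<lambda>j. if j = i then -1 else 0) \<in> monspan n x ?W"
      by (rule monspan_mon) (use that assms in \<open>auto simp: expo_def\<close>)
    then show ?thesis using mon_unit[OF nz, of i "-1"] that assms by (simp add: power_int_minus)
  qed
  ultimately show "laurent N n x \<subseteq> monspan n x ?W" by (rule laurent_least)
  show "monspan n x ?W \<subseteq> laurent N n x"
  proof (rule monspan_subset_subring[OF laurent_subring], rule mon_in_subring[OF laurent_subring])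
    fix w i assume "w \<in> ?W" "i \<in> {1..n}" "w i < 0"
    then show "inverse (x i) \<in> laurent N n x"
      by (intro laurent_gens) (metis (no_types, lifting) Suc_eq_plus1 atLeastAtMost_iff linorder_not_le mem_Collect_eq not_less_eq_eq)
  qed (rule laurent_gens)
qed

lemma laurent_full_eq_monspan:
  "\<forall>i\<in>{1..n}. x i \<noteq> 0 \<Longrightarrow> laurent n n x = monspan n x (expo n)"
  using laurent_eq_monspan[of n x n] by simp

lemma laurent_mono: "N \<le> N' \<Longrightarrow> laurent N n x \<subseteq> laurent N' n x"
  by (rule laurent_least[OF laurent_subring]) (auto intro: laurent_gens)

section \<open>Finite supports and coprimality of binomials\<close>

definition scale :: "int \<Rightarrow> (nat \<Rightarrow> int) \<Rightarrow> (nat \<Rightarrow> int)" where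
  "scale a v = (\<lambda>i. a * v i)"

lemma scale_simps:
  "scale 0 v = 0" "scale 1 v = v" "scale (a + b) v = scale a v + scale b v"
  "scale (a - b) v = scale a v - scale b v" "scale (- a) v = - scale a v"
  by (auto simp: scale_def fun_eq_iff algebra_simps)

lemma scale_expo [simp]: "v \<in> expo n \<Longrightarrow> scale a v \<in> expo n"
  by (simp add: scale_def expo_def)

lemma scale_eq_0_iff: "scale a v = 0 \<longleftrightarrow> a = 0 \<or> v = 0"
  by (auto simp: scale_def fun_eq_iff)

lemma finite_support_no_ray:
  fixes c :: "(nat \<Rightarrow> int) \<Rightarrow> int"
  assumes "finite {w. c w \<noteq> 0}" "v \<noteq> 0"
  shows "\<exists>s::nat. c (w + scale (int s) v) = 0"
proof (rule ccontr)
  assume "\<nexists>s::nat. c (w + scale (int s) v) = 0"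
  then have "range (\<lambda>s::nat. w + scale (int s) v) \<subseteq> {w. c w \<noteq> 0}" by auto
  then have "finite (range (\<lambda>s::nat. w + scale (int s) v))" using assms(1) finite_subset by blast
  moreover have "inj (\<lambda>s::nat. w + scale (int s) v)"
  proof (rule injI)
    fix s t :: nat assume "w + scale (int s) v = w + scale (int t) v"
    then have "scale (int s - int t) v = 0" by (simp add: scale_simps)
    then show "s = t" using assms(2) by (simp add: scale_eq_0_iff)
  qed
  ultimately show False using finite_imageD by blast
qed

text \<open>\<open>d w + d (w - v)\<close> is the coefficient at \<open>w\<close> of the product
  with \<open>1 + mon n x v\<close>. If all other coefficients on the line through \<open>w\<close>
  vanish, a nonzero \<open>d w\<close> propagates along the ray in direction \<open>v\<close>, and a
  nonzero \<open>d (w - v)\<close> along the opposite ray; both contradict finite support.\<close>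

lemma support_multiple_not_isolated:
  fixes d :: "(nat \<Rightarrow> int) \<Rightarrow> int"
  assumes d: "finite {w. d w \<noteq> 0}" "v \<noteq> 0"
    and iso: "\<And>t. t \<noteq> 0 \<Longrightarrow> d (w + scale t v) + d (w + scale t v - v) = 0"
  shows "d w + d (w - v) = 0"
proof -
  have "d w = 0"
  proof (rule ccontr)
    assume nz: "d w \<noteq> 0"
    have "d (w + scale (int s) v) \<noteq> 0" for s
    proof (induction s)
      case (Suc s)
      have eq: "w + scale (int (Suc s)) v - v = w + scale (int s) v"
        by (simp add: scale_simps)
      have "int (Suc s) \<noteq> 0" by simp
      from iso[OF this, unfolded eq] Suc show ?case by linarith
    qed (use nz in \<open>simp only: of_nat_0 scale_simps add_0_right simp_thms\<close>)
    then show False using finite_support_no_ray[OF d, of w] by blast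
  qed
  moreover have "d (w - v) = 0"
  proof (rule ccontr)
    assume nz: "d (w - v) \<noteq> 0"
    have "d (w - v + scale (int s) (- v)) \<noteq> 0" for s
    proof (induction s)
      case (Suc s)
      have eq: "w + scale (- int (Suc s)) v - v = w - v + scale (int (Suc s)) (- v)"
        "w + scale (- int (Suc s)) v = w - v + scale (int s) (- v)"
        by (auto simp: scale_def fun_eq_iff algebra_simps)
      have "- int (Suc s) \<noteq> 0" by simp
      from iso[OF this, unfolded eq(1), unfolded eq(2)] Suc show ?case by linarith
    qed (use nz in \<open>simp only: of_nat_0 scale_simps add_0_right simp_thms\<close>)
    moreover have "- v \<noteq> 0" using d(2) by simp
    ultimately show False using finite_support_no_ray[OF d(1), of "- v" "w - v"] by blast
  qed
  ultimately show ?thesis by simp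
qed

lemma binomial_mult_lev:
  assumes "\<forall>i\<in>{1..n}. x i \<noteq> 0" "finite {w. c w \<noteq> 0}"
  shows "lev n x (\<lambda>w. c (w - u) + c (w - v)) = (mon n x u + mon n x v) * lev n x c"
  using lev_add[OF finite_support_shift[OF assms(2), of u] finite_support_shift[OF assms(2), of v], of n x]
  by (simp add: mon_shift[OF assms] distrib_right)

lemma binomial_mult_support:
  fixes c :: "(nat \<Rightarrow> int) \<Rightarrow> int"
  assumes "finite {w. c w \<noteq> 0}" "{w. c w \<noteq> 0} \<subseteq> expo n" "u \<in> expo n" "v \<in> expo n"
  shows "finite {w. c (w - u) + c (w - v) \<noteq> 0}" "{w. c (w - u) + c (w - v) \<noteq> 0} \<subseteq> expo n"
proof -
  show "finite {w. c (w - u) + c (w - v) \<noteq> 0}"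
    by (rule finite_support_add[OF finite_support_shift finite_support_shift]) fact+
  have "w \<in> expo n" if "c (w - z) \<noteq> 0" "z \<in> expo n" for w z
    using expo_closed(1)[of "w - z" n z] that assms(2) by auto
  then show "{w. c (w - u) + c (w - v) \<noteq> 0} \<subseteq> expo n" 
    using support_add[of "\<lambda>w. c (w - u)" "\<lambda>w. c (w - v)"] assms(3,4) by blast
qed

lemma binomial_nonzero:
  assumes "indep n x" "u \<in> expo n" "v \<in> expo n" "u \<noteq> v"
  shows "mon n x u + mon n x v \<noteq> 0"
proof
  assume "mon n x u + mon n x v = 0"
  then have "mon n x u = - mon n x v" by (simp add: eq_neg_iff_add_eq_0)
  moreover have "- mon n x v \<in> monspan n x {v}" by (intro monspan_minus monspan_mon) simp
  moreover have "mon n x u \<in> monspan n x {u}" by (intro monspan_mon) simp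
  ultimately have "mon n x u = 0"
    using indep_monspan_disjoint[OF assms(1), of "mon n x u" "{u}" "{v}"] assms by simp
  then show False using mon_nonzero[OF indep_nonzero[OF assms(1)]] by blast
qed

lemma mon_shift_mod_binomial:
  assumes x: "\<forall>i\<in>{1..n}. x i \<noteq> 0" and w: "w \<in> expo n" and v: "v \<in> expo n"
  shows "\<exists>h\<in>monspan n x (expo n). \<exists>a. mon n x (w + scale t v) = (1 + mon n x v) * h + of_int a * mon n x w"
proof (induction t rule: int_induct[where k = 0])
  case base
  show ?case by (intro bexI[of _ 0] exI[of _ 1]) (auto simp: scale_simps monspan_zero)
next
  case (step1 t)
  then obtain h a where h: "h \<in> monspan n x (expo n)"
    "mon n x (w + scale t v) = (1 + mon n x v) * h + of_int a * mon n x w" by blast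
  have "mon n x (w + scale (t + 1) v) = mon n x (w + scale t v) * mon n x v"
    by (simp add: scale_simps mon_add[OF x] algebra_simps)
  also have "\<dots> = (1 + mon n x v) * (mon n x (w + scale t v) - h) + of_int (- a) * mon n x w"
    by (simp add: h algebra_simps)
  finally show ?case using h(1) w v
    by (intro bexI[of _ "mon n x (w + scale t v) - h"] exI[of _ "- a"])
      (simp_all only: expo_closed(1) scale_expo monspan_diff monspan_mon)
next
  case (step2 t)
  then obtain h a where h: "h \<in> monspan n x (expo n)"
    "mon n x (w + scale t v) = (1 + mon n x v) * h + of_int a * mon n x w" by blast
  have "mon n x (w + scale t v) = mon n x (w + scale (t - 1) v) * mon n x v"
    by (simp add: scale_simps mon_add[OF x] mon_diff[OF x] mon_nonzero[OF x])
  then have "mon n x (w + scale (t - 1) v) =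
      (1 + mon n x v) * (mon n x (w + scale (t - 1) v) - h) + of_int (- a) * mon n x w"
    using h by (simp add: algebra_simps)
  then show ?case using h(1) w v
    by (intro bexI[of _ "mon n x (w + scale (t - 1) v) - h"] exI[of _ "- a"])
      (simp_all only: expo_closed(1) scale_expo monspan_diff monspan_mon)
qed

text \<open>
  Modulo \<open>1 + y\<^sup>v\<close> each monomial is \<open>\<plusminus>\<close> a chosen representative of its coset of \<open>\<int>v\<close>, and no nonzero
  multiple of \<open>1 + y\<^sup>v\<close> meets a coset in a single monomial. So if \<open>f\<close> is reduced and \<open>1 + y\<^sup>v\<close> divides
  \<open>f (1 + y\<^sup>u)\<close>, the cosets meeting the support of \<open>f\<close> are stable under translation by \<open>-u\<close>; as \<open>u\<close>
  and \<open>v\<close> are independent, \<open>f = 0\<close>.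
\<close>

lemma binomial_prime_to_binomial:
  assumes x: "indep n x" and uv: "u \<in> expo n" "v \<in> expo n"
    and li: "\<And>a b. scale a u + scale b v = 0 \<Longrightarrow> a = 0 \<and> b = 0"
    and f: "f \<in> monspan n x (expo n)" and h': "h' \<in> monspan n x (expo n)"
    and eq: "f * (1 + mon n x u) = (1 + mon n x v) * h'"
  shows "\<exists>h\<in>monspan n x (expo n). f = (1 + mon n x v) * h"
proof -
  note nz = indep_nonzero[OF x]
  have v0: "v \<noteq> 0" using li[of 0 1] by (auto simp: scale_simps)
  \<comment> \<open>The predicate depends only on the coset of \<open>w\<close> modulo multiples of
    \<open>v\<close>, so the choice is constant on cosets.\<close>
  define rep where "rep w = (SOME w'. \<exists>t. w' = w + scale t v)" for w
  have rep_ex: "\<exists>t. rep w = w + scale t v" for w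
  proof -
    have "\<exists>w' t. w' = w + scale t v" by (intro exI) (rule refl)
    from someI_ex[OF this] show ?thesis unfolding rep_def .
  qed
  have rep_shift: "rep (w + scale t v) = rep w" for w t
  proof -
    have "(\<exists>s. w' = w + scale t v + scale s v) \<longleftrightarrow> (\<exists>s. w' = w + scale s v)" for w'
    proof
      assume "\<exists>s. w' = w + scale t v + scale s v"
      then obtain s where "w' = w + scale t v + scale s v" ..
      then have "w' = w + scale (t + s) v" by (simp only: scale_simps add.assoc)
      then show "\<exists>s. w' = w + scale s v" ..
    next
      assume "\<exists>s. w' = w + scale s v"
      then obtain s where "w' = w + scale s v" ..
      then have "w' = w + scale t v + scale (s - t) v" by (simp add: scale_simps)
      then show "\<exists>s. w' = w + scale t v + scale s v" ..
    qed
    then show ?thesis unfolding rep_def by simp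
  qed
  have rep_rep: "rep (rep w) = rep w" for w using rep_ex[of w] rep_shift by metis
  have rep_expo: "rep w \<in> expo n" if "w \<in> expo n" for w using rep_ex[of w] uv that by auto
  have mod: "\<exists>h\<in>monspan n x (expo n). \<exists>f0\<in>monspan n x (rep ` expo n). g = (1 + mon n x v) * h + f0"
    if "g \<in> monspan n x (expo n)" for g
    using that
  proof (induction rule: monspan_induct)
    case zero
    show ?case by (intro bexI[of _ 0]) (auto simp: monspan_zero)
  next
    case (mon a w)
    obtain t where t: "rep w = w + scale t v" using rep_ex by blast
    then have "w = rep w + scale (- t) v" by (simp add: scale_simps)
    then obtain h b where h: "h \<in> monspan n x (expo n)"
      "mon n x w = (1 + mon n x v) * h + of_int b * mon n x (rep w)"
      using mon_shift_mod_binomial[OF nz rep_expo[OF mon] uv(2), of "- t"] by auto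
    have "of_int a * h \<in> monspan n x (expo n)"
      using h(1) subring_of_int laurent_subring laurent_closed(4) laurent_full_eq_monspan[OF nz] by metis
    moreover have "of_int (a * b) * mon n x (rep w) \<in> monspan n x (rep ` expo n)"
      by (rule monspan_scaled_mon) (use mon in simp)
    moreover have "of_int a * mon n x w = (1 + mon n x v) * (of_int a * h) + of_int (a * b) * mon n x (rep w)"
      by (simp add: h algebra_simps)
    ultimately show ?case by blast
  next
    case (add f g)
    then obtain h1 f1 h2 f2 where "h1 \<in> monspan n x (expo n)" "h2 \<in> monspan n x (expo n)"
      "f1 \<in> monspan n x (rep ` expo n)" "f2 \<in> monspan n x (rep ` expo n)"
      "f = (1 + mon n x v) * h1 + f1" "g = (1 + mon n x v) * h2 + f2" by blast
    then show ?case
      by (intro bexI[of _ "h1 + h2"] bexI[of _ "f1 + f2"]) (auto simp: algebra_simps monspan_add)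
  qed
  obtain h f0 where h: "h \<in> monspan n x (expo n)" and f0: "f0 \<in> monspan n x (rep ` expo n)"
    and f_eq: "f = (1 + mon n x v) * h + f0" using mod[OF f] by blast
  \<comment> \<open>Moving \<open>h\<close> to the other side leaves an equation for the reduced
    remainder: \<open>f0 * (1 + mon n x u) = (1 + mon n x v) * g\<close>.\<close>
  define g where "g = h' - h * (1 + mon n x u)"
  have "h * (1 + mon n x u) \<in> monspan n x (expo n)"
    unfolding laurent_full_eq_monspan[OF nz, symmetric]
    by (intro laurent_closed(1,4,5)) (use h monspan_mon[OF uv(1)] in \<open>auto simp: laurent_full_eq_monspan[OF nz]\<close>)
  then have "g \<in> monspan n x (expo n)" unfolding g_def using h' by (rule monspan_diff[rotated])
  then obtain d where d: "finite {w. d w \<noteq> 0}" "{w. d w \<noteq> 0} \<subseteq> expo n" "g = lev n x d"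
    unfolding monspan_def by auto
  obtain c where c: "finite {w. c w \<noteq> 0}" "{w. c w \<noteq> 0} \<subseteq> rep ` expo n" "f0 = lev n x c"
    using f0 unfolding monspan_def by auto
  have cE: "{w. c w \<noteq> 0} \<subseteq> expo n" using c(2) rep_expo by auto
  have E0: "(0 :: nat \<Rightarrow> int) \<in> expo n" by simp
  have "f0 * (1 + mon n x u) = (1 + mon n x v) * g"
    using eq unfolding f_eq g_def by (simp add: algebra_simps)
  then have "lev n x (\<lambda>w. c (w - 0) + c (w - u)) = lev n x (\<lambda>w. d (w - 0) + d (w - v))"
    unfolding binomial_mult_lev[OF nz c(1)] binomial_mult_lev[OF nz d(1)] using c d by (simp add: mult.commute)
  from indep_lev_unique[OF x binomial_mult_support(1)[OF c(1) cE E0 uv(1)] binomial_mult_support(1)[OF d(1,2) E0 uv(2)]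
      binomial_mult_support(2)[OF c(1) cE E0 uv(1)] binomial_mult_support(2)[OF d(1,2) E0 uv(2)] this]
  have cd: "c w + c (w - u) = d w + d (w - v)" for w by simp
  have rep_supp: "rep w = w" if "c w \<noteq> 0" for w
  proof -
    have "w \<in> rep ` expo n" using c(2) that by (simp add: subset_iff)
    then show ?thesis by (auto simp: rep_rep)
  qed
  \<comment> \<open>If the line through \<open>w - u\<close> missed the support of \<open>c\<close>,
    then on the line through \<open>w\<close> the product \<open>f0 * (1 + mon n x u)\<close> would
    have its only nonzero coefficient at \<open>w\<close>, since \<open>f0\<close> is reduced. A
    multiple of \<open>1 + mon n x v\<close> has no such isolated coefficient.\<close>
  have step: "\<exists>t. c (w + scale t v - u) \<noteq> 0" if cw: "c w \<noteq> 0" for w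
  proof (rule ccontr)
    assume "\<nexists>t. c (w + scale t v - u) \<noteq> 0"
    then have neg: "c (w + scale t v - u) = 0" for t by blast
    have wr: "rep w = w" by (rule rep_supp[OF cw])
    have c0: "c (w + scale t v) = 0" if "t \<noteq> 0" for t
    proof (rule ccontr)
      assume "c (w + scale t v) \<noteq> 0"
      then have "rep (w + scale t v) = w + scale t v" by (rule rep_supp)
      then have "w + scale t v = w" using wr rep_shift[of w t] by (simp only:)
      then have "scale t v = 0" by (simp only: add_cancel_left_right)
      then show False using that v0 by (simp add: scale_eq_0_iff)
    qed
    have "d w + d (w - v) = 0"
      by (rule support_multiple_not_isolated[OF d(1) v0])
        (simp only: cd[symmetric] c0 neg add_0_left simp_thms)
    then show False using neg[of 0] cd[of w] cw by (simp only: scale_simps add_0_right)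
  qed
  have "c w = 0" for w
  proof (rule ccontr)
    assume cw: "c w \<noteq> 0"
    have "\<exists>t. c (w + scale t v - scale (int s) u) \<noteq> 0" for s
    proof (induction s)
      case 0
      show ?case by (intro exI[of _ 0]) (use cw in \<open>simp add: scale_simps\<close>)
    next
      case (Suc s)
      then obtain t where "c (w + scale t v - scale (int s) u) \<noteq> 0" by blast
      from step[OF this] obtain t' where "c (w + scale t v - scale (int s) u + scale t' v - u) \<noteq> 0" by blast
      moreover have "w + scale t v - scale (int s) u + scale t' v - u = w + scale (t + t') v - scale (int (Suc s)) u"
        by (simp add: scale_simps)
      ultimately show ?case by metis
    qed
    \<comment> \<open>Repeated translation by \<open>-u\<close>, corrected by multiples
      \<open>T s\<close> of \<open>v\<close>, yields infinitely many support points; they are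
      distinct because \<open>u\<close> and \<open>v\<close> are independent.\<close>
    then obtain T where T: "\<And>s::nat. c (w + scale (T s) v - scale (int s) u) \<noteq> 0" by metis
    have "inj (\<lambda>s::nat. w + scale (T s) v - scale (int s) u)"
    proof (rule injI)
      fix s t :: nat
      assume "w + scale (T s) v - scale (int s) u = w + scale (T t) v - scale (int t) u"
      then have "scale (int t - int s) u + scale (T s - T t) v = 0"
        by (simp add: scale_simps algebra_simps)
      then show "s = t" using li by fastforce
    qed
    moreover have "finite (range (\<lambda>s::nat. w + scale (T s) v - scale (int s) u))"
      using T by (intro finite_subset[OF _ c(1)]) auto
    ultimately show False using finite_imageD by blast
  qed
  then have "f0 = 0" using c(3) by (simp add: lev_def)
  then show ?thesis using f_eq h by auto
qed

text \<open>Apply the preceding divisibility to \<open>f = g * (1 + mon n x v)\<close>, with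
  \<open>h' = g * (1 + mon n x u)\<close>: then \<open>f\<close> is a multiple of
  \<open>1 + mon n x v\<close> inside the Laurent ring, and cancelling the binomial leaves
  \<open>g\<close> there.\<close>

lemma binomials_coprime:
  assumes x: "indep n x" and uv: "u \<in> expo n" "v \<in> expo n"
    and li: "\<And>a b. scale a u + scale b v = 0 \<Longrightarrow> a = 0 \<and> b = 0"
    and g: "g * (1 + mon n x u) \<in> laurent n n x" "g * (1 + mon n x v) \<in> laurent n n x"
  shows "g \<in> laurent n n x"
proof -
  note nz = indep_nonzero[OF x]
  have v0: "v \<noteq> 0" using li[of 0 1] by (auto simp: scale_simps)
  obtain h where h: "h \<in> monspan n x (expo n)" "g * (1 + mon n x v) = (1 + mon n x v) * h"
    using binomial_prime_to_binomial[OF x uv li g(2,1)[unfolded laurent_full_eq_monspan[OF nz]]]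
    by (auto simp: mult_ac)
  moreover have "1 + mon n x v \<noteq> 0" using binomial_nonzero[OF x _ uv(2), of 0] v0 by auto
  ultimately show ?thesis by (simp add: laurent_full_eq_monspan[OF nz])
qed

text \<open>
  Exponents in which some frozen coordinate is negative would propagate along the ray in direction
  \<open>\<plusminus>(u - v)\<close>, contradicting finite support.
\<close>

lemma binomial_prime_to_variable:
  assumes x: "indep n x" and uv: "u \<in> expo n" "v \<in> expo n" "u \<noteq> v"
    and pos: "\<And>i. 0 \<le> u i" "\<And>i. 0 \<le> v i" "\<And>i. u i = 0 \<or> v i = 0"
    and f: "f \<in> laurent n n x" "(mon n x u + mon n x v) * f \<in> laurent N n x" and N: "N \<le> n"
  shows "f \<in> laurent N n x"
proof -
  note nz = indep_nonzero[OF x]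
  let ?W = "{w \<in> expo n. \<forall>i\<in>{N+1..n}. 0 \<le> w i}"
  obtain c where c: "finite {w. c w \<noteq> 0}" "{w. c w \<noteq> 0} \<subseteq> expo n" "f = lev n x c"
    using f(1) unfolding laurent_full_eq_monspan[OF nz] monspan_def by auto
  obtain e where e: "finite {w. e w \<noteq> 0}" "{w. e w \<noteq> 0} \<subseteq> ?W" "(mon n x u + mon n x v) * f = lev n x e"
    using f(2) unfolding laurent_eq_monspan[OF nz N] monspan_def by auto
  have eE: "{w. e w \<noteq> 0} \<subseteq> expo n" using e(2) by auto
  have "lev n x (\<lambda>w. c (w - u) + c (w - v)) = lev n x e"
    using binomial_mult_lev[OF nz c(1), of u v] e(3) c(3) by simp
  from indep_lev_unique[OF x binomial_mult_support(1)[OF c(1,2) uv(1,2)] e(1)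
      binomial_mult_support(2)[OF c(1,2) uv(1,2)] eE this]
  have ce: "c (w - u) + c (w - v) = e w" for w .
  \<comment> \<open>Here \<open>y\<close> is whichever of \<open>u\<close>, \<open>v\<close>
    vanishes at \<open>m\<close>. Adding it keeps coordinate \<open>m\<close> negative, so the
    product has coefficient 0 there, which forces \<open>c\<close> to be nonzero at the point
    shifted by \<open>y - z\<close>; coordinate \<open>m\<close> does not increase along the
    way.\<close>
  have aux: False
    if m: "m \<in> {N+1..n}" "y m = 0" "0 \<le> z m" "y \<noteq> z" and w: "c w \<noteq> 0" "w m < 0"
      and ce': "\<And>w. c (w - y) + c (w - z) = e w" for m y z w
  proof -
    have "c (w + scale (int s) (y - z)) \<noteq> 0 \<and> (w + scale (int s) (y - z)) m < 0" for s
    proof (induction s)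
      case (Suc s)
      let ?w = "w + scale (int s) (y - z)"
      have eq: "w + scale (int (Suc s)) (y - z) = ?w + y - z" by (simp add: scale_simps)
      have wm: "?w m < 0" "c ?w \<noteq> 0" using Suc by blast+
      then have "(?w + y) m < 0" using m(2) by (simp only: plus_fun_apply)
      then have "?w + y \<notin> ?W" using m(1) by force
      then have "e (?w + y) = 0" using e(2) by blast
      then have "c ?w + c (?w + y - z) = 0" using ce'[of "?w + y"] by (simp only: add_diff_cancel_right')
      then have "c (?w + y - z) \<noteq> 0" using wm(2) by linarith
      moreover have "(?w + y - z) m < 0" using wm(1) m(2,3) by (simp only: plus_fun_apply fun_diff_def)
      ultimately show ?case unfolding eq by blast
    qed (use w in \<open>simp add: scale_simps\<close>)
    then show False using finite_support_no_ray[OF c(1), of "y - z" w] m(4) by auto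
  qed
  have "0 \<le> w m" if "c w \<noteq> 0" "m \<in> {N+1..n}" for w m
  proof (rule ccontr)
    assume "\<not> 0 \<le> w m"
    then have wm: "w m < 0" by simp
    from pos(3)[of m] show False
    proof
      assume "u m = 0"
      from aux[OF that(2) this pos(2) uv(3) that(1) wm ce] show False .
    next
      assume "v m = 0"
      from aux[OF that(2) this pos(1) uv(3)[symmetric] that(1) wm] ce show False by (simp add: add.commute)
    qed
  qed
  then have "{w. c w \<noteq> 0} \<subseteq> ?W" using c(2) by auto
  then show ?thesis using c unfolding laurent_eq_monspan[OF nz N] monspan_def by blast
qed

section \<open>Exchange matrices\<close>

lemma skew_symmetrizable_zero_iff:
  assumes "skew_symmetrizable N B" "i \<in> {1..N}" "j \<in> {1..N}"
  shows "B i i = 0" "B i j = 0 \<longleftrightarrow> B j i = 0" "0 < B i j \<longleftrightarrow> B j i < 0"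
proof -
  obtain d :: "nat \<Rightarrow> real" where d: "\<forall>i\<in>{1..N}. d i > 0"
    "\<forall>i\<in>{1..N}. \<forall>j\<in>{1..N}. d i * of_int (B i j) = - (d j * of_int (B j i))"
    using assms(1) unfolding skew_symmetrizable_def by blast
  have p: "d i > 0" "d j > 0" using d assms by auto
  have "d i * of_int (B i i) = - (d i * of_int (B i i))" using d assms by blast
  then have "d i * of_int (B i i) = 0" by linarith
  then show "B i i = 0" using p by simp
  have e: "d i * of_int (B i j) = - (d j * of_int (B j i))" using d assms by blast
  then show "B i j = 0 \<longleftrightarrow> B j i = 0" using p by auto
  have "0 < B i j \<longleftrightarrow> 0 < d i * of_int (B i j)" using p by (simp add: zero_less_mult_iff)
  also have "\<dots> \<longleftrightarrow> d j * of_int (B j i) < 0" unfolding e by simp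
  also have "\<dots> \<longleftrightarrow> B j i < 0" using p by (simp add: mult_less_0_iff)
  finally show "0 < B i j \<longleftrightarrow> B j i < 0" .
qed

text \<open>This form separates the two indices: the correction to row \<open>i\<close> is
  \<open>max 0 (B i k)\<close> times row \<open>k\<close>, plus \<open>B i k\<close> times a vector
  not depending on \<open>i\<close>. Row operations can then be read off.\<close>

lemma mutation_term_div_2:
  fixes a b :: int
  shows "(\<bar>a\<bar> * b + a * \<bar>b\<bar>) div 2 = max 0 a * b + a * max 0 (- b)"
  by (auto simp: abs_if max_def)

lemma mutate_matrix_eq:
  "mutate_matrix k B i j = (if i = k \<or> j = k then - B i j
     else B i j + (max 0 (B i k) * B k j + B i k * max 0 (- B k j)))"
  unfolding mutate_matrix_def mutation_term_div_2 by simp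

lemma mutate_matrix_minus:
  "mutate_matrix k (\<lambda>i j. - B i j) = (\<lambda>i j. - mutate_matrix k B i j)"
  by (intro ext) (auto simp: mutate_matrix_eq max_def algebra_simps)

lemma mutate_cluster_minus: "mutate_cluster n k (\<lambda>i j. - B i j) x = mutate_cluster n k B x"
  by (simp add: mutate_cluster_def add.commute)

lemma skew_symmetrizable_minus:
  "skew_symmetrizable N B \<Longrightarrow> skew_symmetrizable N (\<lambda>i j. - B i j)"
  unfolding skew_symmetrizable_def of_int_minus mult_minus_right neg_equal_iff_equal .

text \<open>The same \<open>d\<close> works. Positive scaling commutes with positive parts, so
  skewness in row and column \<open>k\<close> matches the first correction term at
  \<open>(i, j)\<close> with the negative of the second one at \<open>(j, i)\<close>, and
  conversely.\<close>

lemma skew_symmetrizable_mutate: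
  assumes "skew_symmetrizable N B" "k \<in> {1..N}"
  shows "skew_symmetrizable N (mutate_matrix k B)"
proof -
  obtain d :: "nat \<Rightarrow> real" where d: "\<forall>i\<in>{1..N}. d i > 0"
    and e: "\<And>i j. i \<in> {1..N} \<Longrightarrow> j \<in> {1..N} \<Longrightarrow> d i * of_int (B i j) = - (d j * of_int (B j i))"
    using assms(1) unfolding skew_symmetrizable_def by blast
  have "d i * of_int (mutate_matrix k B i j) = - (d j * of_int (mutate_matrix k B j i))"
    if ij: "i \<in> {1..N}" "j \<in> {1..N}" for i j
  proof (cases "i = k \<or> j = k")
    case True
    then show ?thesis using e[OF ij] by (auto simp: mutate_matrix_eq)
  next
    case False
    have max_mult: "c * max 0 t = max 0 (c * t)" if "0 < c" for c t :: real
      using that by (auto simp: max_def zero_le_mult_iff mult_le_0_iff)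
    define a a' b b' where ab: "a = real_of_int (B i k)" "a' = real_of_int (B k i)"
      "b = real_of_int (B k j)" "b' = real_of_int (B j k)"
    have h: "d i * a = - (d k * a')" "d k * b = - (d j * b')"
      unfolding ab by (rule e[OF ij(1) assms(2)], rule e[OF assms(2) ij(2)])
    have p: "0 < d i" "0 < d j" "0 < d k" using d ij assms(2) by auto
    have "d i * max 0 a = d k * max 0 (- a')" unfolding max_mult[OF p(1)] max_mult[OF p(3)] h(1) by simp
    then have 1: "d i * (max 0 a * b) = - (d j * (b' * max 0 (- a')))"
    proof -
      assume m: "d i * max 0 a = d k * max 0 (- a')"
      have "d i * (max 0 a * b) = (d k * b) * max 0 (- a')" using m by (simp add: mult_ac)
      then show ?thesis unfolding h(2) by (simp add: mult_ac)
    qed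
    have "d k * max 0 (- b) = d j * max 0 b'"
      unfolding max_mult[OF p(2)] max_mult[OF p(3)] using h(2) by simp
    then have 2: "d i * (a * max 0 (- b)) = - (d j * (max 0 b' * a'))"
    proof -
      assume m: "d k * max 0 (- b) = d j * max 0 b'"
      have "d i * (a * max 0 (- b)) = (d i * a) * max 0 (- b)" by (simp add: mult_ac)
      also have "\<dots> = - (a' * (d k * max 0 (- b)))" unfolding h(1) by (simp add: mult_ac)
      finally show ?thesis unfolding m by (simp add: mult_ac)
    qed
    have rmax: "real_of_int (max 0 t) = max 0 (of_int t)" for t by (simp add: max_def)
    show ?thesis using 1 2 e[OF ij] False
      by (simp add: mutate_matrix_eq ab rmax[unfolded of_int_minus] distrib_left)
  qed
  then show ?thesis using d unfolding skew_symmetrizable_def by blast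
qed

definition rows_independent :: "nat \<Rightarrow> nat \<Rightarrow> (nat \<Rightarrow> nat \<Rightarrow> int) \<Rightarrow> bool" where
  "rows_independent N n B \<longleftrightarrow>
     (\<forall>c. (\<forall>j\<in>{1..n}. (\<Sum>i\<in>{1..N}. c i * B i j) = 0) \<longrightarrow> (\<forall>i\<in>{1..N}. c i = 0))"

lemma rows_independent_minus:
  "rows_independent N n B \<Longrightarrow> rows_independent N n (\<lambda>i j. - B i j)"
  unfolding rows_independent_def mult_minus_right sum_negf neg_equal_0_iff_equal .

lemma rows_independentD:
  assumes "rows_independent N n B" "\<And>j. j \<in> {1..n} \<Longrightarrow> (\<Sum>i\<in>{1..N}. c i * B i j) = 0" "i \<in> {1..N}"
  shows "c i = 0"
  using assms(1)[unfolded rows_independent_def, rule_format, of c i] assms(2,3) by blast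

text \<open>Column \<open>k\<close> of a relation \<open>c\<close> among the mutated rows says that
  the old rows other than \<open>k\<close>, combined with the same coefficients, vanish in column
  \<open>k\<close>. This kills the term with \<open>max 0 (- B k j)\<close>. What remains is a
  relation \<open>e\<close> among the old rows, differing from \<open>c\<close> only in the
  coefficient of row \<open>k\<close>.\<close>

lemma rows_independent_mutate:
  assumes B: "rows_independent N n B" and s: "skew_symmetrizable N B" and k: "k \<in> {1..N}" and "N \<le> n"
  shows "rows_independent N n (mutate_matrix k B)"
  unfolding rows_independent_def
proof (intro allI impI)
  fix c assume c: "\<forall>j\<in>{1..n}. (\<Sum>i\<in>{1..N}. c i * mutate_matrix k B i j) = 0"
  have kk: "B k k = 0" using skew_symmetrizable_zero_iff[OF s k] k by blast
  let ?I = "{1..N} - {k}"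
  have split: "(\<Sum>i\<in>{1..N}. f i) = f k + (\<Sum>i\<in>?I. f i)" for f :: "nat \<Rightarrow> int"
    using k by (simp add: sum.remove)
  have "k \<in> {1..n}" using k \<open>N \<le> n\<close> by auto
  then have "(\<Sum>i\<in>{1..N}. c i * mutate_matrix k B i k) = 0" using c by blast
  then have sk: "(\<Sum>i\<in>?I. c i * B i k) = 0"
    unfolding split by (simp add: mutate_matrix_eq kk sum_negf)
  define e where "e i = (if i = k then (\<Sum>i\<in>?I. c i * max 0 (B i k)) - c k else c i)" for i
  have "(\<Sum>i\<in>{1..N}. e i * B i j) = 0" if j: "j \<in> {1..n}" for j
  proof (cases "j = k")
    case True
    then show ?thesis unfolding split using sk by (simp add: e_def kk)
  next
    case False
    have "0 = (\<Sum>i\<in>{1..N}. c i * mutate_matrix k B i j)" using c j by simp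
    also have "\<dots> = - (c k * B k j) + (\<Sum>i\<in>?I. c i * (B i j + (max 0 (B i k) * B k j + B i k * max 0 (- B k j))))"
      unfolding split using False by (simp add: mutate_matrix_eq)
    also have "\<dots> = - (c k * B k j) + (\<Sum>i\<in>?I. c i * B i j) + (\<Sum>i\<in>?I. c i * max 0 (B i k)) * B k j +
        (\<Sum>i\<in>?I. c i * B i k) * max 0 (- B k j)"
      by (simp add: sum.distrib sum_distrib_left sum_distrib_right algebra_simps)
    also have "\<dots> = (\<Sum>i\<in>{1..N}. e i * B i j)"
      unfolding split sk by (simp add: e_def algebra_simps)
    finally show ?thesis by simp
  qed
  then have e0: "e i = 0" if "i \<in> {1..N}" for i by (rule rows_independentD[OF B _ that])
  then have ci: "c i = 0" if "i \<in> ?I" for i using e0[of i] that by (simp add: e_def[of i])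
  moreover have "c k = 0" using e0[OF k] ci by (auto simp: e_def)
  ultimately show "\<forall>i\<in>{1..N}. c i = 0" by blast
qed

text \<open>Cut off outside \<open>{1..n}\<close> because matrix entries there are arbitrary, while
  exponents must lie in \<open>expo n\<close>. The parts \<open>posrow\<close> and
  \<open>negrow\<close> are the exponents of the two exchange monomials.\<close>

definition row :: "nat \<Rightarrow> (nat \<Rightarrow> nat \<Rightarrow> int) \<Rightarrow> nat \<Rightarrow> nat \<Rightarrow> int" where
  "row n B k = (\<lambda>j. if j \<in> {1..n} then B k j else 0)"

definition posrow :: "nat \<Rightarrow> (nat \<Rightarrow> nat \<Rightarrow> int) \<Rightarrow> nat \<Rightarrow> nat \<Rightarrow> int" where
  "posrow n B k = (\<lambda>j. max 0 (row n B k j))"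

definition negrow :: "nat \<Rightarrow> (nat \<Rightarrow> nat \<Rightarrow> int) \<Rightarrow> nat \<Rightarrow> nat \<Rightarrow> int" where
  "negrow n B k = (\<lambda>j. max 0 (- row n B k j))"

lemma row_expo [simp]: "row n B k \<in> expo n" "posrow n B k \<in> expo n" "negrow n B k \<in> expo n"
  by (auto simp: expo_def row_def posrow_def negrow_def)

lemma posrow_eq: "posrow n B k = row n B k + negrow n B k"
  by (auto simp: fun_eq_iff posrow_def negrow_def)

lemma rows_independent_pair:
  assumes "rows_independent N n B" "k \<in> {1..N}" "j \<in> {1..N}" "k \<noteq> j"
    and "scale a (row n B k) + scale b (row n B j) = 0"
  shows "a = 0 \<and> b = 0"
proof -
  define c where "c i = (if i = k then a else if i = j then b else 0)" for i
  have "(\<Sum>i\<in>{1..N}. c i * B i m) = 0" if m: "m \<in> {1..n}" for m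
  proof -
    have "(\<Sum>i\<in>{1..N}. c i * B i m) = (\<Sum>i\<in>{k, j}. c i * B i m)"
      by (rule sum.mono_neutral_right) (use assms in \<open>auto simp: c_def\<close>)
    also have "\<dots> = (scale a (row n B k) + scale b (row n B j)) m"
      using assms(4) m by (simp add: c_def scale_def row_def)
    finally show ?thesis using assms(5) by simp
  qed
  then have "c k = 0" "c j = 0"
    using rows_independentD[OF assms(1), of c] assms(2,3) by blast+
  then show ?thesis using assms(4) by (auto simp: c_def)
qed

text \<open>Excludes the degenerate exchange relation whose right-hand side is the constant 2, which
  arises from a zero row.\<close>

lemma rows_independent_nonzero:
  assumes "rows_independent N n B" "k \<in> {1..N}"
  shows "posrow n B k \<noteq> negrow n B k"
proof
  assume "posrow n B k = negrow n B k"
  then have z: "row n B k = 0" unfolding posrow_eq by simp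
  have "(\<Sum>i\<in>{1..N}. (if i = k then 1 else 0) * B i m) = 0" if m: "m \<in> {1..n}" for m
    using fun_cong[OF z, of m] m assms(2) by (simp add: row_def)
  from rows_independentD[OF assms(1) this assms(2)] show False by simp
qed

lemma mon_rows:
  assumes "\<forall>i\<in>{1..n}. x i \<noteq> 0"
  shows "mon n x (posrow n B k) + mon n x (negrow n B k) = mon n x (negrow n B k) * (1 + mon n x (row n B k))"
  unfolding posrow_eq mon_add[OF assms] by (simp add: algebra_simps)

lemma mutate_cluster_eq:
  fixes x :: "nat \<Rightarrow> 'k::field"
  shows   "mutate_cluster n k B x = x(k := (mon n x (posrow n B k) + mon n x (negrow n B k)) / x k)"
proof -
  have e: "mon n x (posrow n B k) = (\<Prod>j\<in>{j\<in>{1..n}. B k j > 0}. x j ^ nat (B k j))" for B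
  proof -
    have "x j powi posrow n B k j = (if 0 < B k j then x j ^ nat (B k j) else 1)" if "j \<in> {1..n}" for j
      using that by (simp add: posrow_def row_def power_int_def)
    then have "mon n x (posrow n B k) = (\<Prod>j\<in>{1..n}. if 0 < B k j then x j ^ nat (B k j) else 1)"
      unfolding mon_def by (rule prod.cong[OF refl])
    then show ?thesis by (simp only: prod.inter_filter finite_atLeastAtMost)
  qed
  have "negrow n B k = posrow n (\<lambda>i j. - B i j) k"
    by (auto simp: negrow_def posrow_def row_def)
  then show ?thesis by (simp add: mutate_cluster_def e)
qed

section \<open>Exchange of one variable\<close>

text \<open>These are the elements whose denominators are powers of \<open>y\<close>. As they form a
  ring, finding an exponent \<open>m\<close> for a whole Laurent ring reduces to its
  generators.\<close>

lemma denominators_subring: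
  assumes A: "subring A (class_ring :: 'k::field ring)" and y: "y \<in> A"
  shows "subring {f. \<exists>m. f * y ^ m \<in> A} class_ring"
proof (rule subring_class_ringI)
  note C = subring_class_ringD[OF A]
  have "(1::'k) * y ^ 0 \<in> A" using C by simp
  then show "1 \<in> {f. \<exists>m. f * y ^ m \<in> A}" by blast
  show "- a \<in> {f. \<exists>m. f * y ^ m \<in> A}" if a: "a \<in> {f. \<exists>m. f * y ^ m \<in> A}" for a
  proof -
    obtain m where "a * y ^ m \<in> A" using a by blast
    from C(3)[OF this] have "- a * y ^ m \<in> A" by simp
    then show ?thesis by blast
  qed
  fix a b assume "a \<in> {f. \<exists>m. f * y ^ m \<in> A}" "b \<in> {f. \<exists>m. f * y ^ m \<in> A}"
  then obtain l m where lm: "a * y ^ l \<in> A" "b * y ^ m \<in> A" by blast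
  have p: "y ^ i \<in> A" for i by (rule subring_power[OF A y])
  have "a * b * y ^ (l + m) = a * y ^ l * (b * y ^ m)" by (simp add: power_add mult_ac)
  then have "a * b * y ^ (l + m) \<in> A" using C(4)[OF lm] by (simp only:)
  then show "a * b \<in> {f. \<exists>m. f * y ^ m \<in> A}" by blast
  have "(a + b) * y ^ (l + m) = a * y ^ l * y ^ m + b * y ^ m * y ^ l"
    by (simp add: power_add algebra_simps)
  then have "(a + b) * y ^ (l + m) \<in> A"
    using C(5)[OF C(4)[OF lm(1) p] C(4)[OF lm(2) p]] by (simp only:)
  then show "a + b \<in> {f. \<exists>m. f * y ^ m \<in> A}" by blast
qed

text \<open>Coprimality passes to powers: the inner induction removes the factors \<open>z\<close>
  against a single \<open>y\<close>, the outer one removes the factors \<open>y\<close>.\<close>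

lemma coprime_denominators:
  assumes cop: "\<And>g. g * y \<in> A \<Longrightarrow> g * z \<in> A \<Longrightarrow> g \<in> A"
    and A: "subring A (class_ring :: 'k::field ring)" "y \<in> A" "z \<in> A"
  shows "f * y ^ l \<in> A \<Longrightarrow> f * z ^ m \<in> A \<Longrightarrow> f \<in> A"
proof (induction l arbitrary: f)
  case (Suc l)
  have *: "g * y \<in> A \<Longrightarrow> g * z ^ m \<in> A \<Longrightarrow> g \<in> A" for g m
  proof (induction m arbitrary: g)
    case (Suc m)
    have "g * z \<in> A"
      by (rule Suc.IH) (use Suc.prems subring_class_ringD(4)[OF A(1) Suc.prems(1) A(3)] in \<open>auto simp: mult_ac\<close>)
    then show ?case using cop Suc.prems by blast
  qed simp
  have "f * y ^ l \<in> A"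
  proof (rule *)
    show "f * y ^ l * y \<in> A" using Suc.prems(1) by (simp add: mult_ac)
    show "f * y ^ l * z ^ m \<in> A"
      using subring_class_ringD(4)[OF A(1) Suc.prems(2) subring_power[OF A(1,2), of l]] by (simp add: mult_ac)
  qed
  then show ?case using Suc by blast
qed simp

text \<open>Of the exchange matrix only two exponent vectors free of coordinate \<open>k\<close> are
  retained. Thus \<open>P\<close> is the same binomial in \<open>x\<close> and in \<open>x'\<close>,
  and the locale applies to any seed in a chain of exchanges.\<close>

locale exchange =
  fixes n k :: nat and x x' :: "nat \<Rightarrow> 'k::field" and p q :: "nat \<Rightarrow> int" and P :: 'k
  assumes x: "indep n x" and k: "k \<in> {1..n}"
    and pq: "p \<in> expo n" "q \<in> expo n" "p k = 0" "q k = 0" "p \<noteq> q"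
    and P: "P = mon n x p + mon n x q" and x': "x' = x(k := P / x k)"
begin

lemma nz: "\<forall>i\<in>{1..n}. x i \<noteq> 0"
  by (rule indep_nonzero[OF x])

lemma P_nonzero: "P \<noteq> 0"
  unfolding P using binomial_nonzero[OF x] pq by blast

lemma nz': "\<forall>i\<in>{1..n}. x' i \<noteq> 0"
  using nz P_nonzero k by (simp add: x')

lemma x_k: "x k = P / x' k" "x k \<noteq> 0" "x' k \<noteq> 0"
  using nz nz' k P_nonzero by (auto simp: x')

lemma mon_x': "w k = 0 \<Longrightarrow> mon n x' w = mon n x w"
  by (rule mon_cong) (auto simp: x')

lemma P': "P = mon n x' p + mon n x' q"
  using P mon_x' pq by simp

lemma mon_split_k: "\<forall>i\<in>{1..n}. y i \<noteq> 0 \<Longrightarrow> mon n y w = mon n y (w(k := 0)) * y k powi w k"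
proof -
  assume y: "\<forall>i\<in>{1..n}. y i \<noteq> 0"
  have "w = w(k := 0) + (\<lambda>j. if j = k then w k else 0)" by (auto simp: fun_eq_iff)
  then have "mon n y w = mon n y (w(k := 0) + (\<lambda>j. if j = k then w k else 0))" by (simp only:)
  then show ?thesis unfolding mon_add[OF y] mon_unit[OF y k] .
qed

lemma mon_x'_eq: "mon n x' w = mon n x (w(k := - w k)) * P powi w k"
proof -
  have "mon n x' w = mon n x (w(k := 0)) * x' k powi w k"
    using mon_split_k[OF nz', of w] mon_x'[of "w(k := 0)"] by simp
  also have "x' k powi w k = x k powi (- w k) * P powi w k"
    by (simp add: x' power_int_divide_distrib power_int_minus field_simps)
  also have "mon n x (w(k := 0)) * (x k powi (- w k) * P powi w k) = mon n x (w(k := - w k)) * P powi w k"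
    using mon_split_k[OF nz, of "w(k := - w k)"] by simp
  finally show ?thesis .
qed

lemma fun_upd_expo: "w \<in> expo n \<Longrightarrow> w(k := a) \<in> expo n"
  using k by (auto simp: expo_def)

lemma P_in_monspan: "P \<in> monspan n x {w \<in> expo n. w k = 0}" "P \<in> monspan n x' {w \<in> expo n. w k = 0}"
  unfolding P by (rule monspan_add; rule monspan_mon, use pq in simp)
    (subst P[symmetric], subst P', rule monspan_add; rule monspan_mon, use pq in simp)

text \<open>\<open>P\<close> has degree 0 in the exchanged variable, so conditions on the exponent
  at \<open>k\<close> alone survive multiplication by \<open>P\<close>, in either cluster.\<close>

lemma monspan_mult_P_power:
  assumes "\<And>v w. v \<in> W \<Longrightarrow> w \<in> expo n \<Longrightarrow> w k = 0 \<Longrightarrow> v + w \<in> W"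
  shows "f \<in> monspan n x W \<Longrightarrow> f * P ^ m \<in> monspan n x W"
    "f \<in> monspan n x' W \<Longrightarrow> f * P ^ m \<in> monspan n x' W"
proof -
  have 1: "f \<in> monspan n x W \<Longrightarrow> f * P \<in> monspan n x W" for f
    by (rule monspan_mult[OF nz _ P_in_monspan(1)]) (use assms in auto)
  show "f \<in> monspan n x W \<Longrightarrow> f * P ^ m \<in> monspan n x W"
  proof (induction m)
    case (Suc m)
    then show ?case using 1[of "f * P ^ m"] by (simp add: mult_ac)
  qed simp
  have 2: "f \<in> monspan n x' W \<Longrightarrow> f * P \<in> monspan n x' W" for f
    by (rule monspan_mult[OF nz' _ P_in_monspan(2)]) (use assms in auto)
  show "f \<in> monspan n x' W \<Longrightarrow> f * P ^ m \<in> monspan n x' W"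
  proof (induction m)
    case (Suc m)
    then show ?case using 2[of "f * P ^ m"] by (simp add: mult_ac)
  qed simp
qed

text \<open>Substituting \<open>x' k = P / x k\<close> and clearing powers of \<open>P\<close> turns
  a relation in \<open>x'\<close> into one in \<open>x\<close>. Terms of degree \<open>a\<close> in
  \<open>x' k\<close> acquire degree \<open>-a\<close> in \<open>x k\<close>, so they vanish
  separately, and each degree leaves a relation among monomials free of \<open>k\<close>.\<close>

lemma indep_x': "indep n x'"
  unfolding indep_def
proof (intro conjI allI impI, rule nz')
  fix c :: "(nat \<Rightarrow> int) \<Rightarrow> int"
  assume fin: "finite {w. c w \<noteq> 0}" and sub: "{w. c w \<noteq> 0} \<subseteq> expo n" and lev0: "lev n x' c = 0"
  define S where "S = {w. c w \<noteq> 0}"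
  define A where "A = (\<lambda>w. w k) ` S"
  \<comment> \<open>Large enough that multiplication by \<open>P powi b\<close> leaves only
    nonnegative powers of \<open>P\<close>. The inserted 0 keeps the set nonempty when the support
    is empty.\<close>
  define b where "b = Max (insert 0 (uminus ` A))"
  have finA: "finite A" "finite S" using fin by (auto simp: A_def S_def)
  have b: "0 \<le> a + b" if "a \<in> A" for a
  proof -
    have "- a \<le> b" unfolding b_def by (rule Max_ge) (use finA that in auto)
    then show ?thesis by simp
  qed
  define F where "F a = (\<Sum>w | w \<in> S \<and> w k = a. of_int (c w) * mon n x (w(k := 0)))" for a
  define G where "G a = F a * P ^ nat (a + b) * x k powi (- a)" for a
  have "0 = lev n x' c * P powi b" using lev0 by simp
  also have "\<dots> = (\<Sum>w\<in>S. of_int (c w) * mon n x (w(k := 0)) * P ^ nat (w k + b) * x k powi (- w k))"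
    unfolding lev_def S_def[symmetric] sum_distrib_right
  proof (rule sum.cong[OF refl])
    fix w assume w: "w \<in> S"
    have "mon n x' w * P powi b = mon n x (w(k := - w k)) * P powi (w k + b)"
      using P_nonzero by (simp add: mon_x'_eq power_int_add)
    also have "P powi (w k + b) = P ^ nat (w k + b)"
      using b[of "w k"] w by (simp add: A_def power_int_def)
    also have "mon n x (w(k := - w k)) = mon n x (w(k := 0)) * x k powi (- w k)"
      using mon_split_k[OF nz, of "w(k := - w k)"] by simp
    finally show "of_int (c w) * mon n x' w * P powi b =
        of_int (c w) * mon n x (w(k := 0)) * P ^ nat (w k + b) * x k powi (- w k)"
      by (simp add: mult_ac)
  qed
  also have "\<dots> = (\<Sum>a\<in>A. \<Sum>w | w \<in> S \<and> w k = a. of_int (c w) * mon n x (w(k := 0)) * P ^ nat (w k + b) * x k powi (- w k))"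
    unfolding A_def by (rule sum.image_gen[OF finA(2)])
  also have "\<dots> = (\<Sum>a\<in>A. G a)"
    unfolding G_def F_def sum_distrib_right by (intro sum.cong refl) auto
  finally have G0: "(\<Sum>a\<in>A. G a) = 0" by simp
  have F_in: "F a \<in> monspan n x {w \<in> expo n. w k = 0}" for a
    unfolding F_def
    by (intro monspan_sum monspan_scaled_mon) (use sub fun_upd_expo in \<open>auto simp: S_def\<close>)
  have G_in: "G a \<in> monspan n x {w \<in> expo n. w k = - a}" for a
  proof -
    have 1: "F a * P ^ nat (a + b) \<in> monspan n x {w \<in> expo n. w k = 0}"
      by (rule monspan_mult_P_power(1)[OF _ F_in]) auto
    have "(\<lambda>j. if j = k then - a else 0) \<in> expo n" using k by (auto simp: expo_def)
    then have 2: "x k powi (- a) \<in> monspan n x {\<lambda>j. if j = k then - a else 0}"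
      unfolding mon_unit[OF nz k, symmetric] by (intro monspan_mon) simp
    show ?thesis unfolding G_def
      by (rule monspan_mult[OF nz 1 2]) (use k in \<open>auto simp: expo_def\<close>)
  qed
  have Fa: "F a = 0" if a: "a \<in> A" for a
  proof -
    have "G a = - (\<Sum>a'\<in>A - {a}. G a')"
      using G0 sum.remove[OF finA(1) a, of G] by (simp add: eq_neg_iff_add_eq_0)
    moreover have "- (\<Sum>a'\<in>A - {a}. G a') \<in> monspan n x {w \<in> expo n. w k \<noteq> - a}"
    proof (intro monspan_minus monspan_sum)
      fix a' assume "a' \<in> A - {a}"
      then have "{w \<in> expo n. w k = - a'} \<subseteq> {w \<in> expo n. w k \<noteq> - a}" by auto
      then show "G a' \<in> monspan n x {w \<in> expo n. w k \<noteq> - a}"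
        using G_in[of a'] monspan_mono by blast
    qed
    ultimately have G2: "G a \<in> monspan n x {w \<in> expo n. w k \<noteq> - a}" by (simp only:)
    have "G a = 0" by (rule indep_monspan_disjoint[OF x G_in G2]) auto
    then show ?thesis using P_nonzero x_k by (simp add: G_def)
  qed
  show "c = 0"
  proof (rule ext, rule ccontr)
    fix w assume "c w \<noteq> 0 w"
    then have w: "w \<in> S" by (simp add: S_def)
    let ?a = "w k"
    \<comment> \<open>Coefficients of the slice of degree \<open>?a\<close> with coordinate
      \<open>k\<close> erased; within one slice the erasure is injective, so no coefficients
      merge.\<close>
    define e where "e u = (if u k = 0 then c (u(k := ?a)) else 0)" for u
    have supp: "{u. e u \<noteq> 0} = (\<lambda>u. u(k := 0)) ` {u. u \<in> S \<and> u k = ?a}"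
    proof (intro equalityI subsetI)
      fix u assume u: "u \<in> {u. e u \<noteq> 0}"
      then have "u k = 0" "u(k := ?a) \<in> S" by (auto simp: e_def S_def split: if_splits)
      then show "u \<in> (\<lambda>u. u(k := 0)) ` {u. u \<in> S \<and> u k = ?a}"
        by (intro image_eqI[where x = "u(k := ?a)"]) (auto simp: fun_eq_iff)
    next
      fix u assume "u \<in> (\<lambda>u. u(k := 0)) ` {u. u \<in> S \<and> u k = ?a}"
      then obtain v where v: "u = v(k := 0)" "v \<in> S" "v k = ?a" by blast
      have "v(k := ?a) = v" using v(3) by (metis fun_upd_triv)
      then show "u \<in> {u. e u \<noteq> 0}" using v by (simp add: e_def S_def)
    qed
    have inj: "inj_on (\<lambda>u. u(k := 0)) {u. u \<in> S \<and> u k = ?a}"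
      by (rule inj_on_inverseI[where g = "\<lambda>u. u(k := ?a)"]) (auto simp: fun_eq_iff)
    have "lev n x e = (\<Sum>u | u \<in> S \<and> u k = ?a. of_int (e (u(k := 0))) * mon n x (u(k := 0)))"
      unfolding lev_def supp sum.reindex[OF inj] by simp
    also have "\<dots> = F ?a" unfolding F_def
    proof (rule sum.cong[OF refl])
      fix u assume "u \<in> {u. u \<in> S \<and> u k = ?a}"
      then have "u(k := ?a) = u" by (metis (mono_tags, lifting) fun_upd_triv mem_Collect_eq)
      then show "of_int (e (u(k := 0))) * mon n x (u(k := 0)) = of_int (c u) * mon n x (u(k := 0))"
        by (simp add: e_def)
    qed
    also have "\<dots> = 0" by (rule Fa) (use w in \<open>auto simp: A_def\<close>)
    finally have l0: "lev n x e = 0" .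
    have f: "finite {u. e u \<noteq> 0}" unfolding supp using finA(2) by simp
    have "{u. e u \<noteq> 0} \<subseteq> expo n" unfolding supp using sub fun_upd_expo by (auto simp: S_def)
    from indep_levD[OF x f this l0, of "w(k := 0)"] have "c w = 0" by (simp add: e_def)
    then show False using w by (simp add: S_def)
  qed
qed

text \<open>Let \<open>g\<close> be the part without negative powers of \<open>x k\<close>; it lies
  in the Laurent ring of \<open>x'\<close>, hence so does the rest \<open>h0\<close>. Since
  \<open>1 / x k\<close> is \<open>x' k / P\<close>, a power of \<open>P\<close> turns
  \<open>h0\<close> into an expansion with positive powers of \<open>x' k\<close> only. For the part
  \<open>e\<close> of \<open>h0\<close> with nonpositive powers, \<open>e * P ^ m\<close> then has
  two expansions with disjoint supports, so \<open>e = 0\<close>.\<close>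

lemma laurent_inter_split:
  assumes "f \<in> laurent n n x" "f \<in> laurent n n x'"
  shows "\<exists>g\<in>monspan n x {w \<in> expo n. 0 \<le> w k}. \<exists>h\<in>monspan n x' {w \<in> expo n. 0 < w k}. f = g + h"
proof -
  have split: "\<exists>g\<in>monspan n y {w \<in> expo n. Q (w k)}. \<exists>h\<in>monspan n y {w \<in> expo n. \<not> Q (w k)}. f = g + h"
    if "f \<in> monspan n y (expo n)" for f Q and y :: "nat \<Rightarrow> 'k"
    using that
  proof (induction rule: monspan_induct)
    case zero
    show ?case by (intro bexI[of _ 0]) (auto simp: monspan_zero)
  next
    case (mon a w)
    show ?case
    proof (cases "Q (w k)")
      case True
      then show ?thesis using mon
        by (intro bexI[of _ "of_int a * mon n y w"] bexI[of _ 0]) (auto simp: monspan_zero monspan_scaled_mon)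
    next
      case False
      then show ?thesis using mon
        by (intro bexI[of _ 0] bexI[of _ "of_int a * mon n y w"]) (auto simp: monspan_zero monspan_scaled_mon)
    qed
  next
    case (add f1 f2)
    then obtain g1 h1 g2 h2 where *: "g1 \<in> monspan n y {w \<in> expo n. Q (w k)}" "g2 \<in> monspan n y {w \<in> expo n. Q (w k)}"
      "h1 \<in> monspan n y {w \<in> expo n. \<not> Q (w k)}" "h2 \<in> monspan n y {w \<in> expo n. \<not> Q (w k)}"
      "f1 = g1 + h1" "f2 = g2 + h2" by blast
    show ?case
      by (rule bexI[OF _ monspan_add[OF *(1,2)]], rule bexI[OF _ monspan_add[OF *(3,4)]]) (simp add: *)
  qed
  obtain g h0 where g: "g \<in> monspan n x {w \<in> expo n. 0 \<le> w k}"
    and h0: "h0 \<in> monspan n x {w \<in> expo n. \<not> 0 \<le> w k}" and f: "f = g + h0"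
    using split[of f x "\<lambda>a. 0 \<le> a"] assms(1) unfolding laurent_full_eq_monspan[OF nz] by blast
  let ?A = "laurent n n x'"
  have gen: "x i \<in> ?A" "i \<noteq> k \<Longrightarrow> inverse (x i) \<in> ?A" if "i \<in> {1..n}" for i
  proof -
    have P_A: "P \<in> ?A" unfolding laurent_full_eq_monspan[OF nz'] using P_in_monspan(2) monspan_mono[of "{w \<in> expo n. w k = 0}" "expo n"] by blast
    show "x i \<in> ?A"
    proof (cases "i = k")
      case True
      have "P * inverse (x' k) \<in> ?A" using P_A k by (intro laurent_closed(4) laurent_gens)
      then show ?thesis using True x_k(1) by (simp add: divide_inverse)
    qed (use laurent_gens(1)[OF that, of x'] in \<open>simp add: x'\<close>)
    show "i \<noteq> k \<Longrightarrow> inverse (x i) \<in> ?A" using laurent_gens(2)[OF that, of x'] by (simp add: x')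
  qed
  have "monspan n x {w \<in> expo n. 0 \<le> w k} \<subseteq> ?A"
    by (rule monspan_subset_subring[OF laurent_subring], rule mon_in_subring[OF laurent_subring]) (use gen in force)+
  then have "h0 \<in> ?A" using g laurent_closed(6)[OF assms(2), of g] f by auto
  then obtain h e where h: "h \<in> monspan n x' {w \<in> expo n. 0 < w k}"
    and e: "e \<in> monspan n x' {w \<in> expo n. \<not> 0 < w k}" and h0_eq: "h0 = h + e"
    using split[of h0 x' "\<lambda>a. 0 < a"] unfolding laurent_full_eq_monspan[OF nz'] by blast
  have "\<exists>m. h0 * P ^ m \<in> monspan n x' {w \<in> expo n. 0 < w k}" using h0
  proof (induction rule: monspan_induct)
    case (mon a w)
    have "of_int a * mon n x w * P ^ nat (- w k) = of_int a * mon n x' (w(k := - w k))"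
      using mon mon_x'_eq[of "w(k := - w k)"] by (simp add: power_int_def)
    moreover have "of_int a * mon n x' (w(k := - w k)) \<in> monspan n x' {w \<in> expo n. 0 < w k}"
      by (rule monspan_scaled_mon) (use mon fun_upd_expo in auto)
    ultimately show ?case by (intro exI[of _ "nat (- w k)"]) (simp only:)
  next
    case (add f1 f2)
    then obtain l m where lm: "f1 * P ^ l \<in> monspan n x' {w \<in> expo n. 0 < w k}"
      "f2 * P ^ m \<in> monspan n x' {w \<in> expo n. 0 < w k}" by blast
    have "f1 * P ^ l * P ^ m \<in> monspan n x' {w \<in> expo n. 0 < w k}"
      "f2 * P ^ m * P ^ l \<in> monspan n x' {w \<in> expo n. 0 < w k}"
      using lm by (auto intro!: monspan_mult_P_power(2))
    moreover have "(f1 + f2) * P ^ (l + m) = f1 * P ^ l * P ^ m + f2 * P ^ m * P ^ l"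
      by (simp add: power_add algebra_simps)
    ultimately show ?case by (intro exI[of _ "l + m"]) (simp only: monspan_add)
  qed (simp add: monspan_zero)
  then obtain m where m: "h0 * P ^ m \<in> monspan n x' {w \<in> expo n. 0 < w k}" by blast
  have "h * P ^ m \<in> monspan n x' {w \<in> expo n. 0 < w k}"
    by (rule monspan_mult_P_power(2)[OF _ h]) auto
  from monspan_diff[OF m this] have 1: "e * P ^ m \<in> monspan n x' {w \<in> expo n. 0 < w k}"
    by (simp add: h0_eq algebra_simps)
  have 2: "e * P ^ m \<in> monspan n x' {w \<in> expo n. \<not> 0 < w k}"
    by (rule monspan_mult_P_power(2)[OF _ e]) auto
  have "e * P ^ m = 0" by (rule indep_monspan_disjoint[OF indep_x' 1 2]) auto
  then have "e = 0" using P_nonzero by simp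
  then show ?thesis using f g h h0_eq by auto
qed

lemma laurent_transfer:
  assumes f: "f \<in> laurent N n x" "f \<in> laurent n n x'" and N: "k \<in> {1..N}" "N \<le> n"
    and pos: "\<And>i. 0 \<le> p i" "\<And>i. 0 \<le> q i" "\<And>i. p i = 0 \<or> q i = 0"
  shows "f \<in> laurent N n x'"
proof -
  let ?A = "laurent N n x'"
  have sub: "?A \<subseteq> laurent n n x'" by (rule laurent_mono[OF N(2)])
  have "mon n x' w \<in> ?A" if "\<And>i. 0 \<le> w i" for w
    using that
    by (intro mon_in_subring[OF laurent_subring] laurent_gens) (simp_all add: not_less[symmetric])
  then have P_A: "P \<in> ?A" unfolding P' using pos(1,2) by (intro laurent_closed(5)) blast+
  let ?S = "{f. \<exists>m. f * P ^ m \<in> ?A}"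
  have S: "subring ?S class_ring" by (rule denominators_subring[OF laurent_subring P_A])
  have A_S: "a \<in> ?S" if "a \<in> ?A" for a
    using that by (auto intro!: exI[of _ 0])
  have "laurent N n x \<subseteq> ?S"
  proof (rule laurent_least[OF S])
    fix i assume i: "i \<in> {1..n}"
    show "x i \<in> ?S"
    proof (cases "i = k")
      case True
      have "P * inverse (x' k) \<in> ?A" using P_A N by (intro laurent_closed(4) laurent_gens)
      then show ?thesis using True x_k(1) by (intro A_S) (simp add: divide_inverse)
    qed (use A_S laurent_gens(1)[OF i, of x'] in \<open>simp add: x'\<close>)
  next
    fix i assume i: "i \<in> {1..N}"
    show "inverse (x i) \<in> ?S"
    proof (cases "i = k")
      case True
      have "inverse (x k) * P ^ 1 = x' k" by (simp add: x' divide_inverse)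
      then have "inverse (x k) * P ^ 1 \<in> ?A" using laurent_gens(1)[OF k, of x'] by simp
      then show ?thesis using True by blast
    qed (use A_S laurent_gens(2)[OF i, of x'] in \<open>simp add: x'\<close>)
  qed
  then obtain m where m: "f * P ^ m \<in> ?A" using f(1) by blast
  have P_full: "P \<in> laurent n n x'" using P_A sub by blast
  from m show ?thesis
  proof (induction m)
    case (Suc m)
    have "f * P ^ m \<in> laurent n n x'"
      by (intro laurent_closed(4) f(2) subring_power[OF laurent_subring] P_full)
    then have "f * P ^ m \<in> ?A"
      using binomial_prime_to_variable[OF indep_x' pq(1,2,5) pos _ _ N(2), of "f * P ^ m"] Suc.prems
      unfolding P'[symmetric] by (simp add: mult_ac)
    then show ?case by (rule Suc.IH)
  qed simp
qed

end

section \<open>Two successive exchanges\<close>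

definition good_seed :: "nat \<Rightarrow> nat \<Rightarrow> (nat \<Rightarrow> 'k::field) \<Rightarrow> (nat \<Rightarrow> nat \<Rightarrow> int) \<Rightarrow> bool" where
  "good_seed N n x B \<longleftrightarrow> N \<le> n \<and> indep n x \<and> skew_symmetrizable N B \<and> rows_independent N n B"

lemma good_seed_minus: "good_seed N n x B \<Longrightarrow> good_seed N n x (\<lambda>i j. - B i j)"
  by (simp add: good_seed_def skew_symmetrizable_minus rows_independent_minus)

lemma good_seed_exchange:
  assumes "good_seed N n x B" "k \<in> {1..N}"
  shows "exchange n k x (mutate_cluster n k B x) (posrow n B k) (negrow n B k)
    (mon n x (posrow n B k) + mon n x (negrow n B k))"
proof
  have "B k k = 0" using assms skew_symmetrizable_zero_iff[of N B k k] by (auto simp: good_seed_def)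
  then show "posrow n B k k = 0" "negrow n B k k = 0" by (auto simp: posrow_def negrow_def row_def)
  show "posrow n B k \<noteq> negrow n B k"
    using assms rows_independent_nonzero by (auto simp: good_seed_def)
qed (use assms in \<open>auto simp: good_seed_def mutate_cluster_eq\<close>)

lemma good_seed_mutate:
  assumes "good_seed N n x B" "k \<in> {1..N}"
  shows "good_seed N n (mutate_cluster n k B x) (mutate_matrix k B)"
  using exchange.indep_x'[OF good_seed_exchange[OF assms]] assms
    skew_symmetrizable_mutate rows_independent_mutate
  by (auto simp: good_seed_def)

text \<open>A congruence modulo \<open>y\<close>, used with \<open>y\<close> a cluster variable and
  \<open>r + y * z\<close> an exchange binomial, to replace a power of the binomial by a power of
  its unit term.\<close>

lemma subring_add_power:
  assumes A: "subring A (class_ring :: 'k::field ring)" "r \<in> A" "y \<in> A" "z \<in> A"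
  shows "\<exists>t\<in>A. (r + y * z) ^ m = r ^ m + y * t"
proof (induction m)
  case 0
  show ?case by (intro bexI[of _ 0]) (auto simp: subring_class_ringD[OF A(1)])
next
  case (Suc m)
  then obtain t where t: "t \<in> A" "(r + y * z) ^ m = r ^ m + y * t" by blast
  have "(r + y * z) ^ Suc m = (r + y * z) * (r ^ m + y * t)"
    by (simp only: power_Suc t(2))
  also have "\<dots> = r ^ Suc m + y * (r * t + z * r ^ m + y * z * t)"
    by (simp add: algebra_simps)
  finally show ?case
    by (intro bexI[of _ "r * t + z * r ^ m + y * z * t"])
      (use A t in \<open>auto intro!: subring_class_ringD(4,5)[OF A(1)] subring_power[OF A(1)]\<close>)
qed

text \<open>
  The assumption on the sign of \<open>B j k\<close> is harmless, since mutation commutes with \<open>B \<mapsto> -B\<close>.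
\<close>

lemma laurent_two_exchanges_nonneg:
  fixes x :: "nat \<Rightarrow> 'k::field"
  assumes g: "good_seed N n x B" and kj: "k \<in> {1..N}" "j \<in> {1..N}" "k \<noteq> j" and nonneg: "0 \<le> B j k"
    and f: "f \<in> laurent n n x" "f \<in> laurent n n (mutate_cluster n k B x)"
      "f \<in> laurent n n (mutate_cluster n j B x)"
  shows "f \<in> laurent n n (mutate_cluster n j (mutate_matrix k B) (mutate_cluster n k B x))"
proof -
  define x1 where "x1 = mutate_cluster n k B x"
  define B1 where "B1 = mutate_matrix k B"
  define x2 where "x2 = mutate_cluster n j B1 x1"
  define y where "y = mutate_cluster n j B x"
  define P where "P = mon n x (posrow n B k) + mon n x (negrow n B k)"
  define P2 where "P2 = mon n x (posrow n B j) + mon n x (negrow n B j)"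
  define P3 where "P3 = mon n x1 (posrow n B1 j) + mon n x1 (negrow n B1 j)"
  have g1: "good_seed N n x1 B1" unfolding x1_def B1_def by (rule good_seed_mutate[OF g kj(1)])
  interpret E1: exchange n k x x1 "posrow n B k" "negrow n B k" P
    unfolding x1_def P_def by (rule good_seed_exchange[OF g kj(1)])
  interpret E2: exchange n j x y "posrow n B j" "negrow n B j" P2
    unfolding y_def P2_def by (rule good_seed_exchange[OF g kj(2)])
  interpret E3: exchange n j x1 x2 "posrow n B1 j" "negrow n B1 j" P3
    unfolding x2_def P3_def by (rule good_seed_exchange[OF g1 kj(2)])
  define A where "A = laurent n n x2"
  have A: "subring A class_ring" unfolding A_def by (rule laurent_subring)
  note C = subring_class_ringD[OF A]
  have kn: "k \<in> {1..n}" "j \<in> {1..n}" using E1.k E2.k .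
  have skew: "skew_symmetrizable N B" "rows_independent N n B" using g by (auto simp: good_seed_def)
  have B0: "B k k = 0" "B j j = 0" "B j k = 0 \<longleftrightarrow> B k j = 0" "0 < B j k \<longleftrightarrow> B k j < 0"
    using skew_symmetrizable_zero_iff[OF skew(1)] kj by blast+
  have Bkj: "B k j \<le> 0" using B0 nonneg by linarith
  have gen2: "x2 i \<in> A" "inverse (x2 i) \<in> A" if "i \<in> {1..n}" for i
    unfolding A_def using laurent_gens that by blast+
  \<comment> \<open>A monomial free of coordinate \<open>j\<close> has the same value in
    \<open>x1\<close> and in \<open>x2\<close>, whose variables are all units of
    \<open>A\<close>.\<close>
  have mon1: "mon n x1 w \<in> A" "inverse (mon n x1 w) \<in> A" if "w j = 0" for w
  proof -
    have "mon n x2 w \<in> A" for w by (rule mon_in_subring[OF A]) (use gen2 in auto)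
    then show "mon n x1 w \<in> A" "inverse (mon n x1 w) \<in> A"
      unfolding mon_minus[OF E3.nz, symmetric] using E3.mon_x'[of w] E3.mon_x'[of "- w"] that by (metis fun_Compl_def minus_zero)+
  qed
  have x1k: "x1 k \<in> A" "inverse (x1 k) \<in> A"
    using gen2[OF kn(1)] kj(3) by (auto simp: E3.x')
  have P3_A: "P3 \<in> A" unfolding P3_def using mon1(1) E3.pq(3,4) C(5) by blast
  have xj: "x j \<in> A" "x1 j = x j"
  proof -
    show *: "x1 j = x j" using kj(3) by (simp add: E1.x')
    have "P3 * inverse (x2 j) \<in> A" using P3_A gen2(2)[OF kn(2)] C(4) by blast
    then show "x j \<in> A" using E3.x_k(1) * by (simp add: divide_inverse)
  qed
  have xi: "x i \<in> A" "inverse (x i) \<in> A" if "i \<in> {1..n}" "i \<noteq> k" "i \<noteq> j" for i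
    using gen2[OF that(1)] that by (auto simp: E3.x' E1.x')
  \<comment> \<open>With \<open>B k j \<le> 0\<close>, the variable \<open>x j\<close> can occur
    only in the second monomial of \<open>P\<close>, with exponent \<open>c\<close>. Hence
    \<open>P = r + s * x j ^ c\<close> with \<open>r\<close> a unit of \<open>A\<close>.\<close>
  define r where "r = mon n x1 (posrow n B k)"
  define s where "s = mon n x1 ((negrow n B k)(j := 0))"
  define c where "c = nat (- B k j)"
  have posk: "posrow n B k j = 0" using Bkj by (simp add: posrow_def row_def)
  have r: "r \<in> A" "inverse r \<in> A" unfolding r_def using mon1 posk by blast+
  have s: "s \<in> A" unfolding s_def using mon1 by simp
  have P_eq: "P = r + s * x j ^ c"
  proof -
    have "mon n x (negrow n B k) = mon n x1 (negrow n B k)"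
      using E1.mon_x' E1.pq(4) by simp
    also have "\<dots> = s * x j ^ c"
      unfolding E3.mon_split_k[OF E3.nz, of "negrow n B k"] s_def c_def xj(2)
      using Bkj kn by (simp add: negrow_def row_def power_int_def)
    finally show ?thesis unfolding P_def r_def using E1.mon_x' E1.pq(3) by simp
  qed
  have P_A: "P \<in> A" unfolding P_eq using r(1) s xj(1) C(4,5) subring_power[OF A] by blast
  have xk: "x k \<in> A"
    using C(4)[OF P_A x1k(2)] E1.x_k(1) by (simp add: divide_inverse)
  \<comment> \<open>Since \<open>B j k\<close> is nonnegative, mutation at \<open>k\<close> adds
    \<open>B j k\<close> times the positive part of row \<open>k\<close> to row \<open>j\<close>,
    except in column \<open>k\<close>, where the sign changes. The extra factors on the left move
    negative exponents across the identity.\<close>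
  have row_j: "mon n x1 (row n B1 j) * mon n x1 (negrow n B j) * x1 k ^ nat (B j k) =
      mon n x1 ((posrow n B j)(k := 0)) * r ^ nat (B j k)"
  proof -
    define \<beta> where "\<beta> = nat (B j k)"
    have \<beta>: "int \<beta> = B j k" using nonneg by (simp add: \<beta>_def)
    have "(row n B1 j + negrow n B j + (\<lambda>i. if i = k then int \<beta> else 0)) i =
      ((posrow n B j)(k := 0) + (\<lambda>i. int \<beta> * posrow n B k i)) i" for i
    proof -
      consider "i \<notin> {1..n}" | "i = k" | "i = j" | "i \<in> {1..n}" "i \<noteq> k" "i \<noteq> j" by blast
      then show ?thesis
      proof cases
        case 1
        then show ?thesis using kn by (auto simp: row_def negrow_def posrow_def)
      next
        case 2
        then show ?thesis using kn B0 nonneg kj(3)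
          by (simp add: row_def negrow_def posrow_def B1_def mutate_matrix_eq \<beta>)
      next
        case 3
        then show ?thesis using kn B0 nonneg Bkj kj(3)
          by (simp add: row_def negrow_def posrow_def B1_def mutate_matrix_eq \<beta>)
      next
        case 4
        then show ?thesis using kj(3) nonneg
          by (simp add: row_def negrow_def posrow_def B1_def mutate_matrix_eq \<beta> max_def algebra_simps)
      qed
    qed
    then have "row n B1 j + negrow n B j + (\<lambda>i. if i = k then int \<beta> else 0) =
      (posrow n B j)(k := 0) + (\<lambda>i. int \<beta> * posrow n B k i)" by (rule ext)
    from arg_cong[OF this, of "mon n x1"] show ?thesis
      unfolding mon_add[OF E3.nz] mon_scale[OF E3.nz] mon_unit[OF E3.nz kn(1)] r_def \<beta>_def[symmetric]
      by simp
  qed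
  \<comment> \<open>If \<open>B j k = 0\<close>, the exchange binomial at \<open>j\<close> is
    unchanged and \<open>y j = x2 j\<close>. Otherwise compute modulo \<open>x j\<close>: in
    \<open>P2 = p + q * x k ^ \<beta>\<close> put \<open>x k = P / x1 k\<close>, where
    \<open>P\<close> is congruent to \<open>r\<close>. By \<open>row_j\<close>, \<open>P2\<close> is
    congruent to \<open>p * (1 + \<rho>) = p * P3 / \<nu>\<close>, and
    \<open>P3 = x2 j * x j\<close>. So \<open>x j\<close> divides \<open>P2\<close> in
    \<open>A\<close>.\<close>
  have yj: "y j \<in> A"
  proof (cases "B j k = 0")
    case True
    have "B1 j i = B j i" for i
      using kj(3) True by (simp add: B1_def mutate_matrix_eq)
    then have "row n B1 j = row n B j" by (simp add: row_def fun_eq_iff)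
    then have pn: "posrow n B1 j = posrow n B j" "negrow n B1 j = negrow n B j"
      by (simp_all add: posrow_def negrow_def)
    have "posrow n B j k = 0" "negrow n B j k = 0" using True by (auto simp: posrow_def negrow_def row_def)
    then have "P3 = P2" unfolding P3_def P2_def pn using E1.mon_x' by simp
    then have "y j = x2 j" by (simp add: E2.x' E3.x' xj)
    then show ?thesis using gen2 kn by simp
  next
    case False
    then have pos: "0 < B j k" using nonneg by simp
    define \<beta> where "\<beta> = nat (B j k)"
    define p where "p = mon n x1 (negrow n B j)"
    define q where "q = mon n x1 ((posrow n B j)(k := 0))"
    define \<nu> where "\<nu> = mon n x1 (negrow n B1 j)"
    define \<rho> where "\<rho> = mon n x1 (row n B1 j)"
    have nk: "negrow n B j k = 0" using pos by (simp add: negrow_def row_def)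
    have nzs: "p \<noteq> 0" "q \<noteq> 0" "\<nu> \<noteq> 0" "x1 k \<noteq> 0" "x j \<noteq> 0" "x2 j \<noteq> 0"
      unfolding p_def q_def \<nu>_def using mon_nonzero[OF E3.nz] E1.x_k E2.x_k E3.x_k by blast+
    have pA: "p \<in> A" unfolding p_def using mon1 E2.pq(4) by blast
    have qA: "q \<in> A" unfolding q_def using mon1 E2.pq(3) kj(3) by simp
    have \<nu>A: "inverse \<nu> \<in> A" unfolding \<nu>_def using mon1 E3.pq(4) by blast
    have "mon n x (posrow n B j) = mon n x ((posrow n B j)(k := 0)) * x k powi posrow n B j k"
      by (rule E1.mon_split_k[OF E1.nz])
    also have "posrow n B j k = int \<beta>" using kn pos by (simp add: posrow_def row_def \<beta>_def)
    finally have P2_eq: "P2 = p + q * x k ^ \<beta>"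
      unfolding P2_def p_def q_def using E1.mon_x'[of "(posrow n B j)(k := 0)", OF fun_upd_same] E1.mon_x'[of "negrow n B j", OF nk]
    by (simp only: power_int_of_nat add.commute)
    have c1: "0 < c" using B0 pos by (simp add: c_def)
    have "s * x j ^ (c - 1) \<in> A" using s xj C(4) subring_power[OF A] by blast
    from subring_add_power[OF A r(1) xj(1) this, of \<beta>]
    obtain t where t: "t \<in> A" "(r + x j * (s * x j ^ (c - 1))) ^ \<beta> = r ^ \<beta> + x j * t" by blast
    have "x j * (s * x j ^ (c - 1)) = s * x j ^ c"
      using c1 by (cases c) (auto simp: mult_ac)
    from t(2)[unfolded this] have P_pow: "P ^ \<beta> = r ^ \<beta> + x j * t" unfolding P_eq .
    have rho: "\<rho> * p * x1 k ^ \<beta> = q * r ^ \<beta>"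
      using row_j unfolding \<rho>_def p_def q_def \<beta>_def .
    have P3_eq: "P3 = \<nu> * (1 + \<rho>)"
      unfolding P3_def \<nu>_def \<rho>_def by (rule mon_rows[OF E3.nz])
    have "y j = P2 / x j" by (simp add: E2.x')
    also have "P2 = p + q * (r ^ \<beta> + x j * t) / x1 k ^ \<beta>"
      unfolding P2_eq E1.x_k(1) power_divide P_pow by simp
    also have "\<dots> = p + (\<rho> * p * x1 k ^ \<beta>) / x1 k ^ \<beta> + x j * (q * t / x1 k ^ \<beta>)"
      unfolding rho using nzs by (simp add: field_simps)
    also have "\<dots> = p * P3 / \<nu> + x j * (q * t / x1 k ^ \<beta>)"
      unfolding P3_eq using nzs by (simp add: field_simps)
    also have "P3 = x2 j * x j" using nzs by (simp add: E3.x' xj)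
    also have "(p * (x2 j * x j) / \<nu> + x j * (q * t / x1 k ^ \<beta>)) / x j = p * x2 j * inverse \<nu> + q * t * inverse (x1 k) ^ \<beta>"
      using nzs by (simp add: field_simps)
    finally show ?thesis
      using pA qA \<nu>A t(1) x1k(2) gen2(1)[OF kn(2)] by (simp add: C(4,5) subring_power[OF A])
  qed
  have cop: "h \<in> A" if h: "h * x k \<in> A" "h * x j \<in> A" for h
  proof (cases "B j k = 0")
    case False
    then have c1: "0 < c" using B0 nonneg by (simp add: c_def)
    have "s * x j ^ (c - 1) \<in> A" by (rule C(4)[OF s subring_power[OF A xj(1)]])
    then have "h * x k * x1 k - h * x j * (s * x j ^ (c - 1)) \<in> A"
      by (rule C(6)[OF C(4)[OF h(1) x1k(1)] C(4)[OF h(2)]])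
    also have "h * x k * x1 k = h * P" using E1.x_k by simp
    also have "h * P - h * x j * (s * x j ^ (c - 1)) = h * r"
      unfolding P_eq using c1 by (cases c) (auto simp: algebra_simps)
    finally have "h * r * inverse r \<in> A" using r(2) C(4) by blast
    moreover have "r \<noteq> 0" unfolding r_def by (rule mon_nonzero[OF E3.nz])
    ultimately show ?thesis by (simp add: mult.assoc)
  next
    \<comment> \<open>Neither exchange binomial involves the other variable. Up to units of
      \<open>A\<close>, \<open>x k\<close> and \<open>x j\<close> are
      \<open>1 + mon n x2 (row n B k)\<close> and \<open>1 + mon n x2 (row n B j)\<close>, with
      exponents independent as rows of \<open>B\<close>.\<close>
    case True
    then have Bkj0: "B k j = 0" using B0 by simp
    have 1: "h * (1 + mon n x2 (row n B k)) \<in> A"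
    proof -
      have z: "row n B k j = 0" "negrow n B k j = 0" "row n B k k = 0"
        using Bkj0 B0 by (auto simp: row_def negrow_def)
      have e: "mon n x2 (row n B k) = mon n x (row n B k)"
        using E3.mon_x'[of "row n B k", OF z(1)] E1.mon_x'[of "row n B k", OF z(3)] by simp
      have "P = mon n x1 (negrow n B k) * (1 + mon n x2 (row n B k))"
        unfolding P_def mon_rows[OF E1.nz] e using E1.mon_x' E1.pq(4) by simp
      then have "h * (1 + mon n x2 (row n B k)) = h * x k * x1 k * inverse (mon n x1 (negrow n B k))"
        using E1.x_k mon_nonzero[OF E3.nz] by simp
      then show ?thesis
        using C(4)[OF C(4)[OF h(1) x1k(1)] mon1(2)[of "negrow n B k", OF z(2)]] by (simp only:)
    qed
    have 2: "h * (1 + mon n x2 (row n B j)) \<in> A"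
    proof -
      have "B1 j i = B j i" for i
        using kj(3) True by (simp add: B1_def mutate_matrix_eq)
      then have "row n B1 j = row n B j" by (simp add: row_def fun_eq_iff)
      then have rn: "row n B1 j = row n B j" "negrow n B1 j = negrow n B j"
        by (simp_all add: negrow_def)
      have z: "row n B j j = 0" using B0 by (auto simp: row_def negrow_def)
      have "P3 = mon n x1 (negrow n B1 j) * (1 + mon n x2 (row n B j))"
        using mon_rows[OF E3.nz, of B1 j] E3.mon_x'[of "row n B j", OF z] unfolding P3_def rn by simp
      then have "h * (1 + mon n x2 (row n B j)) = h * x j * x2 j * inverse (mon n x1 (negrow n B1 j))"
        using E3.x_k mon_nonzero[OF E3.nz] by (simp add: xj(2)[symmetric])
      then show ?thesis
        using C(4)[OF C(4)[OF h(2) gen2(1)[OF kn(2)]] mon1(2)[of "negrow n B1 j", OF E3.pq(4)]] by (simp only:)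
    qed
    show ?thesis
      using binomials_coprime[OF E3.indep_x' row_expo(1) row_expo(1) rows_independent_pair[OF skew(2) kj] 1[unfolded A_def] 2[unfolded A_def]]
      unfolding A_def .
  qed
  have "\<exists>m. f * x k ^ m \<in> A"
  proof -
    let ?S = "{f. \<exists>m. f * x k ^ m \<in> A}"
    have S: "subring ?S class_ring" by (rule denominators_subring[OF A xk])
    have A_S: "a \<in> ?S" if "a \<in> A" for a using that by (auto intro!: exI[of _ 0])
    have xS: "x i \<in> ?S" if "i \<in> {1..n}" for i
      using xi(1)[OF that] xj(1) xk by (intro A_S) metis
    have "inverse (x k) * x k ^ 1 \<in> A" using C(1) E1.x_k by simp
    then have ixk: "inverse (x k) \<in> ?S" by blast
    have ixS: "inverse (x i) \<in> ?S" if "i \<in> {1..n}" "i \<noteq> j" for i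
      using ixk A_S[OF xi(2)[OF that(1)]] that(2) by (cases "i = k") auto
    \<comment> \<open>Neither part inverts \<open>x j\<close> or \<open>y j\<close>, and both of
      these lie in \<open>A\<close>. The only other generator that may fall outside \<open>A\<close>
      is \<open>inverse (x k)\<close>, so powers of \<open>x k\<close> clear all
      denominators.\<close>
    obtain g h where gh: "g \<in> monspan n x {w \<in> expo n. 0 \<le> w j}" "h \<in> monspan n y {w \<in> expo n. 0 < w j}" "f = g + h"
      using E2.laurent_inter_split[OF f(1) f(3)[folded y_def]] by blast
    have "monspan n x {w \<in> expo n. 0 \<le> w j} \<subseteq> ?S"
      by (rule monspan_subset_subring[OF S], rule mon_in_subring[OF S]) (use xS ixS in force)+
    moreover have "monspan n y {w \<in> expo n. 0 < w j} \<subseteq> ?S"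
    proof (rule monspan_subset_subring[OF S], rule mon_in_subring[OF S])
      fix i assume "i \<in> {1..n}"
      then show "y i \<in> ?S" using xS A_S[OF yj] by (cases "i = j") (auto simp: E2.x')
    next
      fix w i assume "w \<in> {w \<in> expo n. 0 < w j}" "i \<in> {1..n}" "w i < 0"
      moreover from this have "i \<noteq> j" by auto
      ultimately show "inverse (y i) \<in> ?S" using ixS by (simp add: E2.x')
    qed
    ultimately have "f \<in> ?S" using gh subring_class_ringD(5)[OF S] by blast
    then show ?thesis by blast
  qed
  then obtain l where l: "f * x k ^ l \<in> A" by blast
  have "\<exists>m. f * x j ^ m \<in> A"
  proof -
    let ?S = "{f. \<exists>m. f * x j ^ m \<in> A}"
    have S: "subring ?S class_ring" by (rule denominators_subring[OF A xj(1)])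
    have A_S: "a \<in> ?S" if "a \<in> A" for a using that by (auto intro!: exI[of _ 0])
    have "inverse (x j) * x j ^ 1 \<in> A" using C(1) E2.x_k by simp
    then have ixj: "inverse (x j) \<in> ?S" by blast
    \<comment> \<open>\<open>x1\<close> and \<open>x2\<close> differ only at \<open>j\<close>, and
      \<open>x1 j = x j\<close>, so only powers of \<open>x j\<close> have to be cleared.\<close>
    have "laurent n n x1 \<subseteq> ?S"
    proof (rule laurent_least[OF S])
      fix i assume i: "i \<in> {1..n}"
      show "x1 i \<in> ?S" using A_S[OF xj(1)] A_S[OF gen2(1)[OF i]] xj(2) by (cases "i = j") (auto simp: E3.x')
      show "inverse (x1 i) \<in> ?S" using ixj A_S[OF gen2(2)[OF i]] xj(2) by (cases "i = j") (auto simp: E3.x')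
    qed
    then show ?thesis using f(2)[folded x1_def] by blast
  qed
  then obtain m where m: "f * x j ^ m \<in> A" by blast
  have "f \<in> A" by (rule coprime_denominators[OF cop A xk xj(1) l m])
  then show ?thesis unfolding A_def x2_def x1_def B1_def .
qed

lemma laurent_two_exchanges:
  assumes "good_seed N n x B" "k \<in> {1..N}" "j \<in> {1..N}" "k \<noteq> j"
    and "f \<in> laurent n n x" "f \<in> laurent n n (mutate_cluster n k B x)"
      "f \<in> laurent n n (mutate_cluster n j B x)"
  shows "f \<in> laurent n n (mutate_cluster n j (mutate_matrix k B) (mutate_cluster n k B x))"
proof (cases "0 \<le> B j k")
  case False
  then show ?thesis
    using laurent_two_exchanges_nonneg[OF good_seed_minus[OF assms(1)] assms(2-4), of f] assms(5-7)
    by (simp add: mutate_cluster_minus mutate_matrix_minus)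
qed (rule laurent_two_exchanges_nonneg[OF assms(1-4) _ assms(5-7)])

section \<open>Upper bounds\<close>

definition in_upper_bound :: "nat \<Rightarrow> nat \<Rightarrow> (nat \<Rightarrow> 'k::field) \<Rightarrow> (nat \<Rightarrow> nat \<Rightarrow> int) \<Rightarrow> 'k \<Rightarrow> bool" where
  "in_upper_bound N n x B f \<longleftrightarrow> good_seed N n x B \<and> f \<in> laurent N n x \<and>
     (\<forall>k\<in>{1..N}. f \<in> laurent n n (mutate_cluster n k B x))"

text \<open>Mutation at \<open>k\<close> negates row \<open>k\<close>, which merely swaps the two
  exchange monomials, and these do not contain the variable at \<open>k\<close>. Clusters alone are
  compared, because Laurent rings depend on nothing else.\<close>

lemma mutate_cluster_involution:
  assumes "good_seed N n x B" "k \<in> {1..N}"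
  shows "mutate_cluster n k (mutate_matrix k B) (mutate_cluster n k B x) = x"
proof -
  define y where "y = mutate_cluster n k B x"
  interpret exchange n k x y "posrow n B k" "negrow n B k" "mon n x (posrow n B k) + mon n x (negrow n B k)"
    unfolding y_def by (rule good_seed_exchange[OF assms])
  have "row n (mutate_matrix k B) k = (\<lambda>j. - row n B k j)"
    by (auto simp: row_def mutate_matrix_eq)
  then have r: "posrow n (mutate_matrix k B) k = negrow n B k" "negrow n (mutate_matrix k B) k = posrow n B k"
    by (simp_all add: posrow_def negrow_def)
  have "mutate_cluster n k (mutate_matrix k B) y = y(k := x k)"
    unfolding mutate_cluster_eq[of n k "mutate_matrix k B"] r x_k(1) mon_x'[of "posrow n B k", OF pq(3)] mon_x'[of "negrow n B k", OF pq(4)]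
    by (simp only: add.commute)
  then show ?thesis unfolding y_def[symmetric] by (simp add: x')
qed

text \<open>Mutating again at \<open>k\<close> returns to the old cluster. In another direction
  \<open>j\<close> the new neighbour is two exchanges away from the old centre, and the memberships
  at the old centre and at its mutations in \<open>k\<close> and \<open>j\<close> are part of the
  old bound.\<close>

lemma in_upper_bound_mutate:
  assumes "in_upper_bound N n x B f" "k \<in> {1..N}"
  shows "in_upper_bound N n (mutate_cluster n k B x) (mutate_matrix k B) f"
proof -
  note u = assms(1)[unfolded in_upper_bound_def]
  have g: "good_seed N n x B" and N: "N \<le> n" using u by (auto simp: good_seed_def)
  have full: "f \<in> laurent n n x" using u laurent_mono[OF N] by blast
  have "f \<in> laurent N n (mutate_cluster n k B x)"
    by (rule exchange.laurent_transfer[OF good_seed_exchange[OF g assms(2)]])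
      (use u assms(2) N in \<open>auto simp: posrow_def negrow_def max_def\<close>)
  moreover have "f \<in> laurent n n (mutate_cluster n j (mutate_matrix k B) (mutate_cluster n k B x))"
    if "j \<in> {1..N}" for j
  proof (cases "j = k")
    case True
    then show ?thesis using mutate_cluster_involution[OF g assms(2)] full by simp
  next
    case False
    then show ?thesis using laurent_two_exchanges[OF g assms(2) that _ full] u assms(2) that by blast
  qed
  ultimately show ?thesis
    using good_seed_mutate[OF g assms(2)] unfolding in_upper_bound_def by blast
qed

lemma laurent_seed_along:
  assumes "in_upper_bound N n x B f" "set ks \<subseteq> {1..N}"
  shows "f \<in> laurent N n (fst (fold (mutate n) ks (x, B)))"
  using assms
proof (induction ks arbitrary: x B)
  case Nil
  then show ?case by (simp add: in_upper_bound_def)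
next
  case (Cons k ks)
  then show ?case
    using in_upper_bound_mutate[of N n x B f k] by (simp add: mutate_def)
qed

section \<open>The initial seed\<close>

text \<open>Rank \<open>n\<close> makes the columns span the whole space, so a vector orthogonal to
  all columns is orthogonal to every unit vector. This turns rank, here a column notion, into
  independence of rows.\<close>

lemma (in vec_space) full_row_rank_orthogonal:
  assumes A: "A \<in> carrier_mat n nc" and r: "rank A = n"
    and v: "v \<in> carrier_vec n" and orth: "\<And>w. w \<in> set (cols A) \<Longrightarrow> w \<bullet> v = 0"
  shows "v = 0\<^sub>v n"
proof -
  have cA: "set (cols A) \<subseteq> carrier_vec n" using A cols_dim by blast
  obtain S where S: "maximal S (\<lambda>T. T \<subseteq> set (cols A) \<and> lin_indpt T)" "finite S"
    using maximal_exists_superset[of "set (cols A)" "\<lambda>T. T \<subseteq> set (cols A) \<and> lin_indpt T" "{}"]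
      finite_lin_indpt2[of "{}"] by auto
  have S': "S \<subseteq> set (cols A)" "lin_indpt S" using S(1) unfolding maximal_def by blast+
  have "card S = n" using rank_card_indpt[OF A S(1)] r by simp
  then have "basis S"
    using dim_li_is_basis[OF fin_dim S(2) _ S'(2)] S' cA dim_is_n by auto
  then have span: "span S = carrier_vec n" unfolding basis_def by simp
  define W where "W = {w \<in> carrier_vec n. w \<bullet> v = 0}"
  have "submodule class_ring W V"
    unfolding submodule_def W_def using v vec_module
    by (auto simp: add_scalar_prod_distrib[of _ n] smult_scalar_prod_distrib[of _ n])
  then have "span S \<subseteq> W"
    by (rule span_is_subset[rotated]) (use S' cA orth in \<open>auto simp: W_def\<close>)
  then have W: "carrier_vec n \<subseteq> W" using span by simp
  show ?thesis
  proof (rule eq_vecI)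
    fix i assume i: "i < dim_vec (0\<^sub>v n :: 'a vec)"
    then have "unit_vec n i \<in> W" using W by auto
    then have "unit_vec n i \<bullet> v = 0" by (simp add: W_def)
    then show "v $ i = 0\<^sub>v n $ i" using i v by (simp add: scalar_prod_left_unit)
  qed (use v in auto)
qed

lemma full_rank_row_combination:
  assumes "full_rank C" and sum: "\<And>j. j \<in> {1..nvars C} \<Longrightarrow> (\<Sum>i\<in>{1..rk C}. c i * matrix0 C i j) = 0"
    and i: "i \<in> {1..rk C}"
  shows "c i = (0::int)"
proof -
  let ?N = "rk C" and ?n = "nvars C"
  define v :: "rat vec" where "v = vec ?N (\<lambda>i. of_int (c (Suc i)))"
  have A: "exchange_matrix C \<in> carrier_mat ?N ?n" by (simp add: exchange_matrix_def)
  have "v = 0\<^sub>v ?N"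
  proof (rule vec_space.full_row_rank_orthogonal[OF A])
    show "vec_space.rank ?N (exchange_matrix C) = ?N" using assms(1) by (simp add: full_rank_def)
    show "v \<in> carrier_vec ?N" by (simp add: v_def)
    fix w assume "w \<in> set (cols (exchange_matrix C))"
    then obtain j where j: "j < ?n" "w = col (exchange_matrix C) j"
      using A by (auto simp: cols_def)
    have "w \<bullet> v = (\<Sum>i<?N. of_int (c (Suc i) * matrix0 C (Suc i) (Suc j)))"
      using j by (simp add: scalar_prod_def v_def exchange_matrix_def lessThan_atLeast0 mult.commute)
    also have "\<dots> = of_int (\<Sum>i<?N. c (Suc i) * matrix0 C (Suc i) (Suc j))" by simp
    also have "(\<Sum>i<?N. c (Suc i) * matrix0 C (Suc i) (Suc j)) = (\<Sum>i\<in>{1..?N}. c i * matrix0 C i (Suc j))"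
      by (simp add: sum.atLeast1_atMost_eq)
    also have "\<dots> = 0" using sum[of "Suc j"] j by simp
    finally show "w \<bullet> v = 0" by simp
  qed
  moreover obtain i' where "i = Suc i'" "i' < ?N" using i by (cases i) auto
  ultimately have "v $ i' = 0" by simp
  then show ?thesis using \<open>i = Suc i'\<close> \<open>i' < ?N\<close> by (simp add: v_def)
qed

section \<open>From polynomial to Laurent independence\<close>

lemma zpoly_eval_superset:
  assumes "finite S" "Poly_Mapping.keys p \<subseteq> S"
  shows "zpoly_eval x p = (\<Sum>m\<in>S. of_int (Poly_Mapping.lookup p m) *
        (\<Prod>i\<in>Poly_Mapping.keys m. x i ^ Poly_Mapping.lookup m i))"
  unfolding zpoly_eval_def
  by (rule sum.mono_neutral_left) (use assms in \<open>auto simp: in_keys_iff\<close>)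

text \<open>Multiplying by a large common monomial turns a Laurent relation into a polynomial one.
  The map \<open>e\<close> shifts every exponent by the bound \<open>b\<close>; it is injective on
  the support, so no two coefficients are merged.\<close>

lemma alg_independent_imp_indep:
  fixes x :: "nat \<Rightarrow> 'k::field"
  assumes ind: "alg_independent {1..n} x"
  shows "indep n x"
  unfolding indep_def
proof (intro conjI allI impI)
  show nz: "\<forall>i\<in>{1..n}. x i \<noteq> 0"
  proof (intro ballI notI)
    fix i assume i: "i \<in> {1..n}" "x i = 0"
    let ?m = "Poly_Mapping.single i (1::nat)"
    let ?p = "Poly_Mapping.single ?m (1::int)"
    have "zpoly_eval x ?p = 0" using i by (simp add: zpoly_eval_def)
    moreover have "\<forall>m\<in>Poly_Mapping.keys ?p. Poly_Mapping.keys m \<subseteq> {1..n}" using i by simp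
    ultimately have "?p = 0" using ind unfolding alg_independent_def by blast
    then have "Poly_Mapping.lookup ?p ?m = 0" by simp
    then show False by simp
  qed
  fix c :: "(nat \<Rightarrow> int) \<Rightarrow> int"
  assume fin: "finite {w. c w \<noteq> 0}" and sub: "{w. c w \<noteq> 0} \<subseteq> expo n" and lev0: "lev n x c = 0"
  define S where "S = {w. c w \<noteq> 0}"
  have S: "finite S" "S \<subseteq> expo n" using fin sub by (auto simp: S_def)
  define b where "b = Max (insert 0 ((\<lambda>(w, i). - w i) ` (S \<times> {1..n})))"
  have b: "0 \<le> w i + b" if "w \<in> S" "i \<in> {1..n}" for w i
  proof -
    have "- w i \<le> b" unfolding b_def using S that by (intro Max_ge) force+
    then show ?thesis by simp
  qed
  define bv where "bv = (\<lambda>i. if i \<in> {1..n} then b else 0)"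
  define e where "e w = Abs_poly_mapping (\<lambda>i. if i \<in> {1..n} then nat (w i + b) else 0)" for w
  have look: "Poly_Mapping.lookup (e w) i = (if i \<in> {1..n} then nat (w i + b) else 0)" for w i
  proof -
    have "finite {i. (if i \<in> {1..n} then nat (w i + b) else 0) \<noteq> 0}"
      by (rule finite_subset[of _ "{1..n}"]) (auto split: if_splits)
    then show ?thesis unfolding e_def by (simp add: Abs_poly_mapping_inverse)
  qed
  have inj: "inj_on e S"
  proof (rule inj_onI)
    fix v w assume vw: "v \<in> S" "w \<in> S" "e v = e w"
    show "v = w"
    proof (rule expo_eqI)
      fix i assume i: "i \<in> {1..n}"
      have "nat (v i + b) = nat (w i + b)" using look[of v i] look[of w i] vw(3) i by simp
      then show "v i = w i" using b[OF vw(1) i] b[OF vw(2) i] by linarith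
    qed (use vw S in auto)
  qed
  define p where "p = (\<Sum>w\<in>S. Poly_Mapping.single (e w) (c w))"
  have look_p: "Poly_Mapping.lookup p m = (\<Sum>w\<in>S. if e w = m then c w else 0)" for m
    unfolding p_def lookup_sum lookup_single when_def ..
  have look_e: "Poly_Mapping.lookup p (e w) = c w" if "w \<in> S" for w
  proof -
    have "Poly_Mapping.lookup p (e w) = (\<Sum>v\<in>S. if v = w then c v else 0)"
      unfolding look_p by (rule sum.cong) (use inj that in \<open>auto dest: inj_onD\<close>)
    then show ?thesis using S that by simp
  qed
  have keys_p: "Poly_Mapping.keys p \<subseteq> e ` S"
  proof
    fix m assume m: "m \<in> Poly_Mapping.keys p"
    show "m \<in> e ` S"
    proof (rule ccontr)
      assume "m \<notin> e ` S"
      then have "(if e w = m then c w else 0) = 0" if "w \<in> S" for w using that by auto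
      then have "(\<Sum>w\<in>S. if e w = m then c w else 0) = 0" by (intro sum.neutral) blast
      then show False using m by (simp add: in_keys_iff look_p)
    qed
  qed
  have mon_e: "(\<Prod>i\<in>Poly_Mapping.keys (e w). x i ^ Poly_Mapping.lookup (e w) i) = mon n x w * mon n x bv"
    if w: "w \<in> S" for w
  proof -
    have "(\<Prod>i\<in>Poly_Mapping.keys (e w). x i ^ Poly_Mapping.lookup (e w) i) =
        (\<Prod>i\<in>{1..n}. x i ^ Poly_Mapping.lookup (e w) i)"
      by (rule prod.mono_neutral_left) (auto simp: in_keys_iff look split: if_splits)
    also have "\<dots> = mon n x (w + bv)"
      unfolding mon_def
    proof (rule prod.cong[OF refl])
      fix i assume i: "i \<in> {1..n}"
      show "x i ^ Poly_Mapping.lookup (e w) i = x i powi (w + bv) i"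
        using b[OF w i] i by (simp add: look bv_def power_int_def)
    qed
    finally show ?thesis unfolding mon_add[OF nz] .
  qed
  have "zpoly_eval x p = (\<Sum>m\<in>e ` S. of_int (Poly_Mapping.lookup p m) *
        (\<Prod>i\<in>Poly_Mapping.keys m. x i ^ Poly_Mapping.lookup m i))"
    using S keys_p by (intro zpoly_eval_superset) auto
  also have "\<dots> = (\<Sum>w\<in>S. of_int (c w) * (mon n x w * mon n x bv))"
    unfolding sum.reindex[OF inj] by (rule sum.cong) (auto simp: look_e mon_e)
  also have "\<dots> = lev n x c * mon n x bv"
    by (simp only: lev_def S_def sum_distrib_right mult.assoc)
  finally have z: "zpoly_eval x p = 0" using lev0 by simp
  have "Poly_Mapping.keys m \<subseteq> {1..n}" if "m \<in> Poly_Mapping.keys p" for m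
    using that keys_p by (auto simp: in_keys_iff look split: if_splits)
  then have "p = 0" using ind z unfolding alg_independent_def by blast
  then have "c w = 0" if "w \<in> S" for w using look_e[OF that] by simp
  then show "c = 0" by (intro ext) (auto simp: S_def)
qed

section \<open>Transport along a quasi-isomorphism\<close>

definition field_iso :: "('k::field \<Rightarrow> 'l::field) \<Rightarrow> bool" where
  "field_iso \<Psi> \<longleftrightarrow> (\<forall>a b. \<Psi> (a + b) = \<Psi> a + \<Psi> b) \<and> (\<forall>a b. \<Psi> (a * b) = \<Psi> a * \<Psi> b) \<and>
     \<Psi> 1 = 1 \<and> bij \<Psi>"

lemma field_iso_class_ring:
  "\<Psi> \<in> ring_iso (class_ring :: 'k::field ring) (class_ring :: 'l::field ring) \<Longrightarrow> field_iso \<Psi>"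
  unfolding ring_iso_def Ring.ring_hom_def field_iso_def by simp

context
  fixes \<Psi> :: "'k::field \<Rightarrow> 'l::field"
  assumes iso: "field_iso \<Psi>"
begin

lemma field_iso_simps:
  "\<Psi> (a + b) = \<Psi> a + \<Psi> b" "\<Psi> (a * b) = \<Psi> a * \<Psi> b" "\<Psi> 1 = 1" "\<Psi> 0 = 0" "\<Psi> (- a) = - \<Psi> a"
  "\<Psi> a = \<Psi> b \<longleftrightarrow> a = b"
proof -
  show add: "\<Psi> (a + b) = \<Psi> a + \<Psi> b" for a b using iso by (simp add: field_iso_def)
  show "\<Psi> (a * b) = \<Psi> a * \<Psi> b" "\<Psi> 1 = 1" using iso by (simp_all add: field_iso_def)
  show z: "\<Psi> 0 = 0" using add[of 0 0, symmetric, unfolded add_0_left] by (simp only: add_cancel_left_right)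
  show "\<Psi> (- a) = - \<Psi> a" using add[of a "- a"] z by (simp add: eq_neg_iff_add_eq_0 add.commute)
  show "\<Psi> a = \<Psi> b \<longleftrightarrow> a = b" using iso by (auto simp: field_iso_def bij_def inj_def)
qed

lemma field_iso_eq_0_iff: "\<Psi> a = 0 \<longleftrightarrow> a = 0"
  using field_iso_simps(6)[of a 0] by (simp add: field_iso_simps(4))

lemma field_iso_inverse: "\<Psi> (inverse a) = inverse (\<Psi> a)"
proof (cases "a = 0")
  case False
  then have "\<Psi> a * \<Psi> (inverse a) = 1"
    by (simp add: field_iso_simps(2)[symmetric] field_iso_simps(3))
  then show ?thesis by (simp add: inverse_unique)
qed (simp add: field_iso_simps)

lemma field_iso_power: "\<Psi> (a ^ m) = \<Psi> a ^ m"
  by (induction m) (simp_all add: field_iso_simps)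

lemma field_iso_powi: "\<Psi> (a powi m) = \<Psi> a powi m"
  by (simp add: power_int_def field_iso_power field_iso_inverse)

lemma field_iso_prod: "\<Psi> (prod f I) = (\<Prod>i\<in>I. \<Psi> (f i))"
  by (induction I rule: infinite_finite_induct) (simp_all add: field_iso_simps)

lemma field_iso_of_int: "\<Psi> (of_int m) = of_int m"
proof -
  have "\<Psi> (of_nat i) = of_nat i" for i
    by (induction i) (simp_all add: field_iso_simps)
  then show ?thesis by (cases m) (simp_all add: field_iso_simps del: of_nat_Suc)
qed

lemma field_iso_subring_image:
  assumes A: "subring A class_ring"
  shows "subring (\<Psi> ` A) class_ring"
proof (rule subring_class_ringI)
  note C = subring_class_ringD[OF A]
  show "1 \<in> \<Psi> ` A" by (rule image_eqI[of 1 \<Psi> 1, OF field_iso_simps(3)[symmetric] C(1)])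
  show "- a \<in> \<Psi> ` A" if "a \<in> \<Psi> ` A" for a
    using that C(3) by (auto simp: field_iso_simps(5)[symmetric])
  show "a * b \<in> \<Psi> ` A" "a + b \<in> \<Psi> ` A" if "a \<in> \<Psi> ` A" "b \<in> \<Psi> ` A" for a b
    using that C(4,5) by (auto simp: field_iso_simps(1,2)[symmetric])
qed

end

text \<open>Fractions over \<open>A\<close> contain \<open>H\<close> and are closed under the field
  operations. Numerators and denominators, unlike general elements of the field, have supports that
  can be compared.\<close>

lemma generate_field_fraction:
  assumes A: "subring A (class_ring :: 'k::field ring)" "H \<subseteq> A" and g: "g \<in> generate_field class_ring H"
  shows "\<exists>a\<in>A. \<exists>b\<in>A. b \<noteq> 0 \<and> g = a / b"
proof -
  note C = subring_class_ringD[OF A(1)]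
  show ?thesis using g
  proof (induction rule: generate_field.induct)
    case one
    show ?case using subring_class_ringD(1)[OF A(1)]
      by (intro bexI[of _ 1]) (simp_all add: class_ring_simps)
  next
    case (incl h)
    then show ?case using subring_class_ringD(1)[OF A(1)] A(2) by (intro bexI[of _ h] bexI[of _ 1]) auto
  next
    case (a_inv h)
    then obtain a b where ab: "a \<in> A" "b \<in> A" "b \<noteq> 0" "h = a / b" by blast
    show ?case unfolding ab(4)
      by (intro bexI[OF _ C(3)[OF ab(1)]] bexI[OF _ ab(2)]) (simp add: ab(3) class_ring_simps)
  next
    case (m_inv h)
    then obtain a b where ab: "a \<in> A" "b \<in> A" "b \<noteq> 0" "h = a / b" by blast
    have "a \<noteq> 0" using m_inv(2) ab(4) by auto
    then show ?case unfolding ab(4)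
      by (intro bexI[OF _ ab(2)] bexI[OF _ ab(1)]) (simp add: ab(3) class_ring_simps)
  next
    case (eng_add g h)
    then obtain a b c d where ab: "a \<in> A" "b \<in> A" "b \<noteq> 0" "g = a / b"
      and cd: "c \<in> A" "d \<in> A" "d \<noteq> 0" "h = c / d" by blast
    show ?case unfolding ab(4) cd(4)
      by (intro bexI[OF _ C(5)[OF C(4)[OF ab(1) cd(2)] C(4)[OF cd(1) ab(2)]]] bexI[OF _ C(4)[OF ab(2) cd(2)]])
        (simp add: ab(3) cd(3) class_ring_simps add_frac_eq)
  next
    case (eng_mult g h)
    then obtain a b c d where ab: "a \<in> A" "b \<in> A" "b \<noteq> 0" "g = a / b"
      and cd: "c \<in> A" "d \<in> A" "d \<noteq> 0" "h = c / d" by blast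
    show ?case unfolding ab(4) cd(4)
      by (intro bexI[OF _ C(4)[OF ab(1) cd(1)]] bexI[OF _ C(4)[OF ab(2) cd(2)]])
        (simp add: ab(3) cd(3) class_ring_simps)
  qed
qed

lemma mon_powi:
  assumes "\<forall>i\<in>{1..n}. x i \<noteq> 0"
  shows "mon n x (\<lambda>i. a * u i) = mon n x u powi a"
proof (cases "0 \<le> a")
  case True
  then show ?thesis using mon_scale[OF assms, of "nat a" u] by (simp add: power_int_def)
next
  case False
  have "(\<lambda>i. a * u i) = - (\<lambda>i. int (nat (- a)) * u i)" using False by (simp add: fun_eq_iff)
  then have "mon n x (\<lambda>i. a * u i) = inverse (mon n x (\<lambda>i. int (nat (- a)) * u i))"
    using mon_minus[OF assms, of "\<lambda>i. int (nat (- a)) * u i"] by (simp only:)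
  then show ?thesis using False unfolding mon_scale[OF assms] by (simp add: power_int_def power_inverse)
qed

lemma mon_sum:
  assumes "\<forall>i\<in>{1..n}. x i \<noteq> 0"
  shows "mon n x (\<lambda>i. \<Sum>j\<in>J. u j i) = (\<Prod>j\<in>J. mon n x (u j))"
proof (induction J rule: infinite_finite_induct)
  case (insert j J)
  have "(\<lambda>i. \<Sum>j\<in>insert j J. u j i) = u j + (\<lambda>i. \<Sum>j\<in>J. u j i)"
    using insert by (simp add: fun_eq_iff)
  then show ?case using insert by (simp only: mon_add[OF assms] prod.insert simp_thms)
qed (simp_all add: mon_def)

section \<open>Clusters, ambient fields and localizations\<close>

lemma laurent_ring_eq: "laurent_ring C x = laurent (rk C) (nvars C) x"
  by (simp add: laurent_ring_def laurent_def)

lemma fst_fold_mutate: "i \<notin> set ks \<Longrightarrow> fst (fold (mutate n) ks s) i = fst s i"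
  by (induction ks arbitrary: s) (auto simp: mutate_def mutate_cluster_def)

lemma cluster_along_frozen: "i \<notin> set ks \<Longrightarrow> cluster_along C ks i = cluster0 C i"
  by (simp add: cluster_along_def seed_along_def fst_fold_mutate)

lemma generate_field_subring: "subring (generate_field class_ring H) (class_ring :: 'k::field ring)"
  by (rule subring_class_ringI)
    (use generate_field.one[of "class_ring :: 'k ring"] generate_field.a_inv[of _ "class_ring :: 'k ring"]
      generate_field.eng_add[of _ "class_ring :: 'k ring"] generate_field.eng_mult[of _ "class_ring :: 'k ring"]
      in \<open>simp_all add: class_ring_simps\<close>)

lemma generate_field_inverse:
  "h \<in> generate_field (class_ring :: 'k::field ring) H \<Longrightarrow> inverse h \<in> generate_field class_ring H"
  using generate_field.m_inv[of h "class_ring :: 'k ring" H]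
  by (cases "h = 0") (simp_all add: class_ring_simps)

lemma cluster_along_in_ambient_field:
  assumes "set ks \<subseteq> {1..nvars C}" "i \<in> {1..nvars C}"
  shows "cluster_along C ks i \<in> ambient_field C"
proof -
  let ?F = "ambient_field C" and ?n = "nvars C"
  have F: "subring ?F class_ring" unfolding ambient_field_def by (rule generate_field_subring)
  have inv: "inverse h \<in> ?F" if "h \<in> ?F" for h
    using that unfolding ambient_field_def by (rule generate_field_inverse)
  have "fst (fold (mutate ?n) ks s) i \<in> ?F"
    if "\<And>i. i \<in> {1..?n} \<Longrightarrow> fst s i \<in> ?F" "set ks \<subseteq> {1..?n}" for s
    using that
  proof (induction ks arbitrary: s)
    case Nil
    then show ?case using assms(2) by simp
  next
    case (Cons k ks)
    have mon: "mon ?n (fst s) w \<in> ?F" for w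
      by (rule mon_in_subring[OF F]) (use Cons.prems(1) inv in auto)
    have "(mon ?n (fst s) u + mon ?n (fst s) v) / fst s k \<in> ?F" for u v
      unfolding divide_inverse using mon inv Cons.prems subring_class_ringD(4,5)[OF F] by simp
    then have "fst (mutate ?n k s) i \<in> ?F" if "i \<in> {1..?n}" for i
      using Cons.prems(1)[OF that] by (simp add: mutate_def mutate_cluster_eq)
    then show ?case using Cons.IH[of "mutate ?n k s"] Cons.prems(2) by simp
  qed
  moreover have "cluster0 C i \<in> ?F" if "i \<in> {1..?n}" for i
    unfolding ambient_field_def using that by (intro generate_field.incl) simp
  ultimately show ?thesis
    using assms(1) unfolding cluster_along_def seed_along_def by (metis fst_conv)
qed

lemma upper_cluster_algebra_subset:
  assumes "set ks \<subseteq> {1..rk C}"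
  shows "upper_cluster_algebra C \<subseteq> laurent_ring C (cluster_along C ks)"
proof -
  have "seed_along C ks \<in> seeds C" using assms by (auto simp: seeds_def)
  then show ?thesis unfolding upper_cluster_algebra_def cluster_along_def
    by (auto simp: case_prod_beta)
qed

lemma localize_subset:
  assumes "subring A (class_ring :: 'k::field ring)" "R \<subseteq> A" "inverse ` S \<subseteq> A"
  shows "localize R S \<subseteq> A"
  unfolding localize_def using assms by (intro generate_ring_least) auto

lemma subset_localize: "R \<subseteq> localize R S"
  unfolding localize_def by (auto intro: generate_ring.incl)

text \<open>
  \<open>\<Psi>\<close> maps the monomials in \<open>y\<close> to the monomials in \<open>z\<close> with exponents in a lattice. Writing the
  preimage of the variable \<open>z\<close> at \<open>\<kappa> j\<close> as a fraction \<open>a / b\<close>, the supports of \<open>\<Psi> a\<close> and of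
  that variable times \<open>\<Psi> b\<close> must meet, hence the lattice contains the exponent of the variable.
\<close>

lemma marked_variable_is_image_of_monomial:
  fixes y :: "nat \<Rightarrow> 'k::field" and z :: "nat \<Rightarrow> 'l::field"
  assumes iso: "field_iso \<Psi>" and y: "indep n y" and z: "indep n z"
    and \<kappa>: "bij_betw \<kappa> {1..n} {1..n}" and I: "I \<subseteq> {1..n}"
    and out: "\<And>i. i \<in> {1..n} - I \<Longrightarrow> \<Psi> (y i) = z (\<kappa> i) * (\<Prod>j\<in>I. z (\<kappa> j) powi l i j)"
    and ins: "\<And>i. i \<in> I \<Longrightarrow> \<Psi> (y i) = (\<Prod>j\<in>I. z (\<kappa> j) powi l i j)"
    and j: "j \<in> I" and g: "g \<in> generate_field class_ring (y ` {1..n})" "\<Psi> g = z (\<kappa> j)"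
  shows "\<exists>v\<in>expo n. (\<forall>i. i \<notin> I \<longrightarrow> v i = 0) \<and> \<Psi> (mon n y v) = z (\<kappa> j)"
proof -
  note nzy = indep_nonzero[OF y] and nzz = indep_nonzero[OF z]
  have \<kappa>n: "\<kappa> i \<in> {1..n}" if "i \<in> {1..n}" for i using \<kappa> that by (auto simp: bij_betw_def)
  have \<kappa>I: "\<kappa> i \<in> {1..n}" if "i \<in> I" for i using \<kappa>n I that by blast
  have \<kappa>inj: "\<kappa> i = \<kappa> i' \<longleftrightarrow> i = i'" if "i \<in> {1..n}" "i' \<in> {1..n}" for i i'
    by (rule inj_on_eq_iff[OF bij_betw_imp_inj_on[OF \<kappa>] that])
  \<comment> \<open>Exponents in \<open>z\<close>: \<open>V i\<close> collects the marked factors of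
    \<open>\<Psi> (y i)\<close>, \<open>U i\<close> is its full exponent vector, and
    \<open>L\<close> extends \<open>U\<close> linearly, so that \<open>\<Psi>\<close> acts on
    monomials through \<open>L\<close>.\<close>
  define V where "V i m = (\<Sum>j\<in>I. if m = \<kappa> j then l i j else 0)" for i m
  define U where "U i = (\<lambda>m. if i \<notin> I \<and> m = \<kappa> i then 1 else 0) + V i" for i
  define L where "L w = (\<lambda>m. \<Sum>i\<in>{1..n}. w i * U i m)" for w
  have V_out: "V i m = 0" if "m \<notin> \<kappa> ` I" for i m
    unfolding V_def using that by (intro sum.neutral) auto
  have monV: "mon n z (V i) = (\<Prod>j\<in>I. z (\<kappa> j) powi l i j)" for i
  proof -
    have "mon n z (V i) = (\<Prod>j\<in>I. mon n z (\<lambda>m. if m = \<kappa> j then l i j else 0))"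
      unfolding V_def by (rule mon_sum[OF nzz])
    also have "\<dots> = (\<Prod>j\<in>I. z (\<kappa> j) powi l i j)"
      by (rule prod.cong[OF refl mon_unit[OF nzz \<kappa>I]])
    finally show ?thesis .
  qed
  have monU: "\<Psi> (y i) = mon n z (U i)" if i: "i \<in> {1..n}" for i
  proof (cases "i \<in> I")
    case True
    then have "(\<lambda>m. if i \<notin> I \<and> m = \<kappa> i then 1 else 0) = (0 :: nat \<Rightarrow> int)" by (simp add: fun_eq_iff)
    then have "U i = V i" unfolding U_def by (simp only: add_0_left)
    then show ?thesis using ins[OF True] monV by simp
  next
    case False
    then have "U i = (\<lambda>m. if m = \<kappa> i then 1 else 0) + V i" by (simp add: U_def)
    then show ?thesis using out[of i] i False
      by (simp only: mon_add[OF nzz] mon_unit[OF nzz \<kappa>n[OF i]] monV power_int_1_right Diff_iff simp_thms)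
  qed
  have monL: "\<Psi> (mon n y w) = mon n z (L w)" for w
  proof -
    have "\<Psi> (mon n y w) = (\<Prod>i\<in>{1..n}. \<Psi> (y i) powi w i)"
      unfolding mon_def field_iso_prod[OF iso] field_iso_powi[OF iso] ..
    also have "\<dots> = (\<Prod>i\<in>{1..n}. mon n z (\<lambda>m. w i * U i m))"
      by (rule prod.cong[OF refl]) (simp only: monU mon_powi[OF nzz])
    also have "\<dots> = mon n z (L w)" unfolding L_def by (rule mon_sum[OF nzz, symmetric])
    finally show ?thesis .
  qed
  have U_expo: "U i \<in> expo n" if "i \<in> {1..n}" for i
  proof -
    have "V i m = 0" if "m \<notin> {1..n}" for m by (rule V_out) (use \<kappa>I that in blast)
    then show ?thesis using \<kappa>n[OF that] by (auto simp: expo_def U_def)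
  qed
  have L_expo: "L w \<in> expo n" for w
    using U_expo unfolding expo_def L_def by (auto intro!: sum.neutral)
  have L_diff: "L (v - w) = L v - L w" for v w
    by (simp add: L_def fun_eq_iff left_diff_distrib sum_subtractf)
  \<comment> \<open>For unmarked \<open>i\<close>, only \<open>y i\<close> contributes to coordinate
    \<open>\<kappa> i\<close>, with exponent 1. Hence a preimage under \<open>L\<close> of a marked
    unit vector vanishes at all unmarked indices.\<close>
  have L_out: "L w (\<kappa> i) = w i" if i: "i \<in> {1..n} - I" for w i
  proof -
    have "\<kappa> i \<notin> \<kappa> ` I" using i I \<kappa>inj by auto
    then have "U i' (\<kappa> i) = (if i' = i then 1 else 0)" if "i' \<in> {1..n}" for i'
      using V_out \<kappa>inj[of i i'] i that by (auto simp: U_def)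
    then have "L w (\<kappa> i) = (\<Sum>i'\<in>{1..n}. if i' = i then w i else 0)"
      unfolding L_def by (intro sum.cong) auto
    then show ?thesis using i by simp
  qed
  have img: "\<Psi> f \<in> monspan n z (L ` expo n)" if "f \<in> monspan n y (expo n)" for f
    using that
  proof (induction rule: monspan_induct)
    case zero
    then show ?case by (simp add: field_iso_simps[OF iso] monspan_zero)
  next
    case (mon a w)
    then show ?case
      by (simp add: field_iso_simps(2)[OF iso] field_iso_of_int[OF iso] monL monspan_scaled_mon)
  next
    case (add f g)
    then show ?case by (simp add: field_iso_simps(1)[OF iso] monspan_add)
  qed
  define e :: "nat \<Rightarrow> int" where "e = (\<lambda>m. if m = \<kappa> j then 1 else 0)"
  have \<kappa>j: "\<kappa> j \<in> {1..n}" using \<kappa>I j by blast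
  have e: "e \<in> expo n" "mon n z e = z (\<kappa> j)"
    using \<kappa>j mon_unit[OF nzz \<kappa>j, of 1] by (auto simp: expo_def e_def)
  have "y ` {1..n} \<subseteq> laurent n n y" using laurent_gens(1) by blast
  from generate_field_fraction[OF laurent_subring this g(1), unfolded laurent_full_eq_monspan[OF nzy]]
  obtain a b where ab: "a \<in> monspan n y (expo n)" "b \<in> monspan n y (expo n)" "b \<noteq> 0" "g = a / b"
    by (elim bexE conjE)
  have "a = g * b" using ab by simp
  then have \<Psi>a: "\<Psi> a = mon n z e * \<Psi> b" by (simp add: field_iso_simps(2)[OF iso] g(2) e(2))
  have 1: "\<Psi> a \<in> monspan n z (L ` expo n)" by (rule img[OF ab(1)])
  have 2: "\<Psi> a \<in> monspan n z ((\<lambda>u. e + u) ` L ` expo n)"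
    unfolding \<Psi>a by (rule monspan_mult[OF nzz monspan_mon[of e "{e}"] img[OF ab(2)]]) auto
  have "e \<in> L ` expo n"
  proof (rule ccontr)
    assume ne: "e \<notin> L ` expo n"
    have "L ` expo n \<inter> (\<lambda>u. e + u) ` L ` expo n = {}"
    proof (rule ccontr)
      assume "L ` expo n \<inter> (\<lambda>u. e + u) ` L ` expo n \<noteq> {}"
      then obtain v w where vw: "v \<in> expo n" "w \<in> expo n" "L v = e + L w" by blast
      then have "e = L (v - w)" by (simp only: L_diff add_diff_cancel_right')
      then show False using ne expo_closed(2)[OF vw(1,2)] by blast
    qed
    moreover have "L ` expo n \<subseteq> expo n" "(\<lambda>u. e + u) ` L ` expo n \<subseteq> expo n"
      using L_expo e(1) by auto
    ultimately have "\<Psi> a = 0"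
      using indep_monspan_disjoint[OF z 1 2] by blast
    then have "z (\<kappa> j) = 0"
      using \<Psi>a ab(3) e(2) by (simp add: field_iso_eq_0_iff[OF iso])
    then show False using nzz \<kappa>j by blast
  qed
  then obtain v where v: "v \<in> expo n" "e = L v" by blast
  have "v i = 0" if "i \<notin> I" for i
  proof (cases "i \<in> {1..n}")
    case True
    then have "v i = e (\<kappa> i)" using L_out[of i v] that v(2) by simp
    also have "\<dots> = 0" using \<kappa>inj[of i j] True j I that by (auto simp: e_def)
    finally show ?thesis .
  next
    case False
    then show ?thesis using v(1) unfolding expo_def by blast
  qed
  then show ?thesis using v monL[of v] e(2) by metis
qed

text \<open>Let \<open>A\<close> be the Laurent ring of the marked cluster. It suffices that its
  image under \<open>\<Psi>\<close> contains the Laurent ring of the related cluster and the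
  inverses of the marked target variables: then it contains the localized base ring on the side of
  \<open>C'\<close>, into which \<open>\<Psi>\<close> sends the base ring on the side of
  \<open>C\<close>. Injectivity of \<open>\<Psi>\<close> brings the inclusion back.\<close>

lemma base_ring_subset_laurent_ring:
  fixes C :: "'r::idom fract cluster_data" and C' :: "'s::idom fract cluster_data"
  assumes cs: "cluster_structure C" "cluster_structure C'"
    and rel: "related_triple C C' \<kappa>" and qi: "quasi_isomorphism C C' \<kappa> Q" and bir: "birational C C' \<kappa> Q"
    and up: "base_ring \<subseteq> upper_cluster_algebra C'"
    and ks: "set ks \<subseteq> {1..rk C} - marked_source C C' \<kappa>"
  shows "base_ring \<subseteq> laurent_ring C (cluster_along C ks)"
proof -
  define n where "n = nvars C"
  define I where "I = marked_source C C' \<kappa>"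
  define S' where "S' = cluster0 C' ` marked_target C C' \<kappa>"
  define x where "x = cluster_along C ks"
  define x' where "x' = cluster_along C' (map \<kappa> ks)"
  have n': "nvars C' = n" and \<kappa>: "bij_betw \<kappa> {1..n} {1..n}"
    and \<kappa>_frozen: "\<kappa> ` {rk C + 1..n} \<subseteq> {rk C' + 1..n}"
    using rel by (auto simp: related_triple_def n_def)
  have N: "rk C \<le> n" "rk C' \<le> n" unfolding n_def using n' by (auto simp: nvars_def n_def)
  have y: "indep n (cluster0 C)" and z: "indep n (cluster0 C')"
    using cs alg_independent_imp_indep n' by (auto simp: cluster_structure_def n_def)
  have \<kappa>n: "\<kappa> i \<in> {1..n}" if "i \<in> {1..n}" for i using \<kappa> that by (auto simp: bij_betw_def)
  have I_iff: "i \<in> I \<longleftrightarrow> i \<in> {1..rk C} \<and> rk C' < \<kappa> i" for i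
  proof
    assume "i \<in> I"
    then have i: "i \<in> {1..n}" "\<kappa> i \<in> {rk C' + 1..n}" "\<kappa> i \<in> \<kappa> ` {1..rk C}"
      using n' by (auto simp: I_def marked_source_def marked_target_def n_def)
    then obtain i' where i': "\<kappa> i = \<kappa> i'" "i' \<in> {1..rk C}" by blast
    have "i' \<in> {1..n}" using i'(2) N(1) by auto
    then have "i = i'" using inj_on_eq_iff[OF bij_betw_imp_inj_on[OF \<kappa>] i(1)] i'(1) by blast
    then show "i \<in> {1..rk C} \<and> rk C' < \<kappa> i" using i i' by auto
  next
    assume "i \<in> {1..rk C} \<and> rk C' < \<kappa> i"
    then show "i \<in> I"
      using \<kappa>n[of i] N n' by (auto simp: I_def marked_source_def marked_target_def n_def)
  qed
  have I: "I \<subseteq> {1..n}" using I_iff N by fastforce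
  have finI: "finite I" using I finite_subset by blast
  have ks': "set ks \<subseteq> {1..rk C} - I" using ks by (simp add: I_def)
  have "\<kappa> i \<in> {1..rk C'}" if "i \<in> {1..rk C} - I" for i
    using that I_iff[of i] \<kappa>n[of i] N(1) by auto
  then have \<kappa>ks: "set (map \<kappa> ks) \<subseteq> {1..rk C'}" using ks' by auto
  have x_I: "x i = cluster0 C i" "x' (\<kappa> i) = cluster0 C' (\<kappa> i)" if "i \<in> I" for i
  proof -
    show "x i = cluster0 C i" unfolding x_def by (rule cluster_along_frozen) (use ks' that in blast)
    have "\<kappa> i \<notin> set (map \<kappa> ks)" using \<kappa>ks that I_iff[of i] by fastforce
    then show "x' (\<kappa> i) = cluster0 C' (\<kappa> i)" unfolding x'_def by (rule cluster_along_frozen)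
  qed
  obtain \<psi> \<Psi> where \<psi>: "\<psi> \<in> ring_iso (subring_of (localize base_ring (cluster0 C ` I))) (subring_of (localize base_ring S'))"
    and \<Psi>: "\<Psi> \<in> ring_iso (class_ring :: 'r fract ring) (class_ring :: 's fract ring)"
    and ext: "\<forall>a \<in> localize base_ring (cluster0 C ` I). \<Psi> a = \<psi> a" "\<forall>f \<in> ambient_field C. \<Psi> f = Q f"
    using bir unfolding birational_def Let_def I_def S'_def by blast
  have iso: "field_iso \<Psi>" by (rule field_iso_class_ring[OF \<Psi>])
  have Q: "bij_betw Q (ambient_field C) (ambient_field C')"
    using qi unfolding quasi_isomorphism_def ring_iso_def by simp
  define A where "A = laurent (rk C) n x"
  have A: "subring A class_ring" unfolding A_def by (rule laurent_subring)
  note IA = field_iso_subring_image[OF iso A]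
  note D = subring_class_ringD[OF IA]
  have quasi: "\<exists>l :: nat \<Rightarrow> nat \<Rightarrow> int.
      (\<forall>i\<in>{1..n} - I. Q (cluster_along C ks i) = cluster_along C' (map \<kappa> ks) (\<kappa> i) * (\<Prod>j\<in>I. cluster_along C' (map \<kappa> ks) (\<kappa> j) powi l i j)) \<and>
      (\<forall>i\<in>I. Q (cluster_along C ks i) = (\<Prod>j\<in>I. cluster_along C' (map \<kappa> ks) (\<kappa> j) powi l i j))"
    if "set ks \<subseteq> {1..rk C} - I" for ks
    using qi that unfolding quasi_isomorphism_def Let_def I_def n_def by blast
  \<comment> \<open>Marked variables are never mutated along \<open>ks\<close>, so the monomial
    relations at the initial clusters can be used. A marked target variable is then the image of a
    monomial in marked source variables, which are mutable and hence units of
    \<open>A\<close>.\<close>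
  have marked: "x' (\<kappa> j) \<in> \<Psi> ` A \<and> inverse (x' (\<kappa> j)) \<in> \<Psi> ` A" if j: "j \<in> I" for j
  proof -
    have c0: "cluster_along C [] = cluster0 C" "cluster_along C' [] = cluster0 C'"
      by (simp_all add: cluster_along_def seed_along_def)
    have "set [] \<subseteq> {1..rk C} - I" by simp
    from quasi[OF this, unfolded list.map c0] obtain l :: "nat \<Rightarrow> nat \<Rightarrow> int" where
      l: "\<forall>i\<in>{1..n} - I. Q (cluster0 C i) = cluster0 C' (\<kappa> i) * (\<Prod>j\<in>I. cluster0 C' (\<kappa> j) powi l i j)"
        "\<forall>i\<in>I. Q (cluster0 C i) = (\<Prod>j\<in>I. cluster0 C' (\<kappa> j) powi l i j)"
      by blast
    have amb: "cluster0 C i \<in> ambient_field C" if "i \<in> {1..n}" for i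
      unfolding ambient_field_def using that by (intro generate_field.incl) (simp add: n_def)
    have "cluster0 C' (\<kappa> j) \<in> ambient_field C'"
      unfolding ambient_field_def using \<kappa>n[of j] I j n' by (intro generate_field.incl) auto
    then obtain g where g: "g \<in> ambient_field C" "Q g = cluster0 C' (\<kappa> j)"
      using Q by (metis bij_betw_imp_surj_on imageE)
    have "\<exists>v\<in>expo n. (\<forall>i. i \<notin> I \<longrightarrow> v i = 0) \<and> \<Psi> (mon n (cluster0 C) v) = cluster0 C' (\<kappa> j)"
    proof (rule marked_variable_is_image_of_monomial[OF iso y z \<kappa> I _ _ j])
      show "g \<in> generate_field class_ring (cluster0 C ` {1..n})" using g(1) by (simp add: ambient_field_def n_def)
      show "\<Psi> g = cluster0 C' (\<kappa> j)" using g ext(2) by simp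
      show "\<Psi> (cluster0 C i) = cluster0 C' (\<kappa> i) * (\<Prod>j\<in>I. cluster0 C' (\<kappa> j) powi l i j)"
        if "i \<in> {1..n} - I" for i using ext(2) amb bspec[OF l(1) that] that by simp
      show "\<Psi> (cluster0 C i) = (\<Prod>j\<in>I. cluster0 C' (\<kappa> j) powi l i j)"
        if "i \<in> I" for i using ext(2) amb bspec[OF l(2) that] that I by auto
    qed
    then obtain v where v: "v \<in> expo n" "\<And>i. i \<notin> I \<Longrightarrow> v i = 0" "\<Psi> (mon n (cluster0 C) v) = x' (\<kappa> j)"
      using x_I(2)[OF j] by auto
    have e: "mon n (cluster0 C) v = mon n x v"
      by (rule mon_cong) (use v(2) x_I(1) in metis)
    have gen: "x i \<in> A" "inverse (x i) \<in> A" if "w i \<noteq> 0" "\<And>i. i \<notin> I \<Longrightarrow> w i = 0" for w :: "nat \<Rightarrow> int" and i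
    proof -
      have "i \<in> I" using that by blast
      then show "x i \<in> A" "inverse (x i) \<in> A" unfolding A_def
        using I_iff[of i] I by (auto intro!: laurent_gens)
    qed
    have mon_A: "mon n x w \<in> A" if "\<And>i. i \<notin> I \<Longrightarrow> w i = 0" for w
      by (rule mon_in_subring[OF A]) (use gen[of w, OF _ that] in auto)
    have "mon n (cluster0 C) (- v) = mon n x (- v)"
      by (rule mon_cong) (use v(2) x_I(1) in \<open>metis fun_Compl_def minus_zero\<close>)
    then have "inverse (mon n (cluster0 C) v) \<in> A"
      using mon_A[of "- v"] v(2) unfolding mon_minus[OF indep_nonzero[OF y], symmetric] by simp
    moreover have "mon n (cluster0 C) v \<in> A" unfolding e by (rule mon_A[OF v(2)])
    ultimately show ?thesis
      unfolding v(3)[symmetric] field_iso_inverse[OF iso, symmetric] by blast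
  qed
  obtain l :: "nat \<Rightarrow> nat \<Rightarrow> int" where
    l: "\<And>i. i \<in> {1..n} - I \<Longrightarrow> Q (x i) = x' (\<kappa> i) * (\<Prod>j\<in>I. x' (\<kappa> j) powi l i j)"
    using quasi[OF ks'] unfolding x_def x'_def by blast
  have unit: "(\<Prod>j\<in>I. x' (\<kappa> j) powi a j) \<in> \<Psi> ` A" for a
    by (intro subring_prod[OF IA] subring_powi[OF IA]) (use marked in auto)
  have unit_nz: "(\<Prod>j\<in>I. x' (\<kappa> j) powi a j) \<noteq> 0" for a
    using finI x_I(2) indep_nonzero[OF z] \<kappa>n I by auto
  have unit_inv: "inverse (\<Prod>j\<in>I. x' (\<kappa> j) powi l i j) = (\<Prod>j\<in>I. x' (\<kappa> j) powi (- l i j))" for i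
    by (simp add: prod_inversef[symmetric] power_int_minus comp_def)
  have x_amb: "Q (x i) = \<Psi> (x i)" if "i \<in> {1..n}" for i
  proof -
    have "set ks \<subseteq> {1..nvars C}" using ks' N(1) by (auto simp: n_def)
    then have "x i \<in> ambient_field C"
      unfolding x_def using that by (intro cluster_along_in_ambient_field) (simp_all add: n_def)
    then show ?thesis using ext(2) by simp
  qed
  \<comment> \<open>An unmarked variable of the related cluster is \<open>\<Psi> (x i)\<close> up to
    a product of powers of marked target variables, a unit of the image of \<open>A\<close> by
    \<open>marked\<close>.\<close>
  have gens: "x' (\<kappa> i) \<in> \<Psi> ` A" "\<kappa> i \<in> {1..rk C'} \<Longrightarrow> inverse (x' (\<kappa> i)) \<in> \<Psi> ` A" if i: "i \<in> {1..n}" for i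
  proof -
    have "x' (\<kappa> i) \<in> \<Psi> ` A \<and> (\<kappa> i \<in> {1..rk C'} \<longrightarrow> inverse (x' (\<kappa> i)) \<in> \<Psi> ` A)"
    proof (cases "i \<in> I")
      case True
      then show ?thesis using marked by blast
    next
      case False
      then have eq: "\<Psi> (x i) = x' (\<kappa> i) * (\<Prod>j\<in>I. x' (\<kappa> j) powi l i j)"
        using l[of i] i x_amb[OF i] by simp
      then have "x' (\<kappa> i) = \<Psi> (x i) * inverse (\<Prod>j\<in>I. x' (\<kappa> j) powi l i j)"
        using unit_nz by simp
      moreover have "\<Psi> (x i) \<in> \<Psi> ` A" unfolding A_def using i by (intro imageI laurent_gens)
      ultimately have 1: "x' (\<kappa> i) \<in> \<Psi> ` A" unfolding unit_inv using unit D(4) by simp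
      have "inverse (x' (\<kappa> i)) \<in> \<Psi> ` A" if "\<kappa> i \<in> {1..rk C'}"
      proof -
        \<comment> \<open>\<open>\<kappa>\<close> sends frozen indices to frozen indices, so a
          mutable image forces \<open>i\<close> to be mutable and \<open>x i\<close> to be
          invertible in \<open>A\<close>.\<close>
        have "i \<in> {1..rk C}"
        proof (rule ccontr)
          assume "i \<notin> {1..rk C}"
          then have "i \<in> {rk C + 1..n}" using i by auto
          then have "\<kappa> i \<in> {rk C' + 1..n}" using \<kappa>_frozen by blast
          then show False using that by auto
        qed
        then have "\<Psi> (inverse (x i)) \<in> \<Psi> ` A" unfolding A_def by (intro imageI laurent_gens)
        moreover have "inverse (x' (\<kappa> i)) = \<Psi> (inverse (x i)) * (\<Prod>j\<in>I. x' (\<kappa> j) powi l i j)"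
          unfolding field_iso_inverse[OF iso] eq using unit_nz by simp
        ultimately show ?thesis using unit D(4) by simp
      qed
      then show ?thesis using 1 by blast
    qed
    then show "x' (\<kappa> i) \<in> \<Psi> ` A" "\<kappa> i \<in> {1..rk C'} \<Longrightarrow> inverse (x' (\<kappa> i)) \<in> \<Psi> ` A" by blast+
  qed
  have surj: "\<exists>i\<in>{1..n}. m = \<kappa> i" if "m \<in> {1..n}" for m
    using \<kappa> that by (auto simp: bij_betw_def)
  have "laurent (rk C') n x' \<subseteq> \<Psi> ` A"
  proof (rule laurent_least[OF IA])
    show "x' m \<in> \<Psi> ` A" if "m \<in> {1..n}" for m using surj[OF that] gens(1) by blast
    show "inverse (x' m) \<in> \<Psi> ` A" if m: "m \<in> {1..rk C'}" for m
    proof -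
      have "m \<in> {1..n}" using m N by auto
      from surj[OF this] show ?thesis using gens(2) m by blast
    qed
  qed
  moreover have "base_ring \<subseteq> laurent (rk C') n x'"
    using up upper_cluster_algebra_subset[OF \<kappa>ks] unfolding x'_def laurent_ring_eq n' by blast
  moreover have "inverse ` S' \<subseteq> \<Psi> ` A"
  proof
    fix a assume "a \<in> inverse ` S'"
    then obtain m where m: "m \<in> marked_target C C' \<kappa>" "a = inverse (cluster0 C' m)" by (auto simp: S'_def)
    then obtain i where i: "i \<in> {1..rk C}" "m = \<kappa> i" "rk C' < \<kappa> i" by (auto simp: marked_target_def)
    then have "i \<in> I" using I_iff by blast
    then show "a \<in> \<Psi> ` A" using marked x_I(2) m i by auto
  qed
  ultimately have loc: "localize base_ring S' \<subseteq> \<Psi> ` A" by (intro localize_subset[OF IA]) blast+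
  show ?thesis
  proof
    fix f :: "'r fract" assume "f \<in> base_ring"
    then have f: "f \<in> localize base_ring (cluster0 C ` I)" using subset_localize by blast
    then have "\<Psi> f \<in> localize base_ring S'"
      using \<psi> ext(1) unfolding ring_iso_def bij_betw_def by auto
    then obtain a where "a \<in> A" "\<Psi> f = \<Psi> a" using loc by blast
    then show "f \<in> laurent_ring C (cluster_along C ks)"
      by (simp add: field_iso_simps(6)[OF iso] laurent_ring_eq A_def n_def x_def)
  qed
qed

theorem proposition4p9:
  fixes C :: "'r::idom fract cluster_data"
    and C' :: "'s::idom fract cluster_data"
    and \<kappa> :: "nat \<Rightarrow> nat"
    and Q :: "'r fract \<Rightarrow> 's fract"
  assumes "noetherian_idom TYPE('r)" and "normal_idom TYPE('r)"
    and "noetherian_idom TYPE('s)" and "normal_idom TYPE('s)"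
    and "cluster_structure C" and "cluster_structure C'"
    and "related_triple C C' \<kappa>"
    and "quasi_isomorphism C C' \<kappa> Q" and "birational C C' \<kappa> Q"
    and "full_rank C" and "full_rank C'"
    and "base_ring \<subseteq> upper_cluster_algebra C'"
    and "\<forall>i \<in> marked_source C C' \<kappa>. base_ring \<subseteq> laurent_ring C (cluster_along C [i])"
  shows "base_ring \<subseteq> upper_cluster_algebra C"
proof
  note transfer = base_ring_subset_laurent_ring[OF assms(5-9,12)]
  fix f :: "'r fract" assume f: "f \<in> base_ring"
  have N: "rk C \<le> nvars C" by (simp add: nvars_def)
  have "rows_independent (rk C) (nvars C) (matrix0 C)"
    unfolding rows_independent_def using full_rank_row_combination[OF assms(10)] by blast
  then have "good_seed (rk C) (nvars C) (cluster0 C) (matrix0 C)"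
    using assms(5) N alg_independent_imp_indep by (auto simp: good_seed_def cluster_structure_def)
  moreover have "f \<in> laurent (rk C) (nvars C) (cluster0 C)"
    using transfer[of "[]"] f by (auto simp: laurent_ring_eq cluster_along_def seed_along_def)
  moreover have "f \<in> laurent (nvars C) (nvars C) (mutate_cluster (nvars C) k (matrix0 C) (cluster0 C))"
    if k: "k \<in> {1..rk C}" for k
  proof -
    have "base_ring \<subseteq> laurent_ring C (cluster_along C [k])"
      using assms(13) transfer[of "[k]"] k by (cases "k \<in> marked_source C C' \<kappa>") auto
    then have "f \<in> laurent (rk C) (nvars C) (mutate_cluster (nvars C) k (matrix0 C) (cluster0 C))"
      using f by (auto simp: laurent_ring_eq cluster_along_def seed_along_def mutate_def)
    \<comment> \<open>Neighbours enter the upper bound only with their frozen variables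
      inverted.\<close>
    then show ?thesis using laurent_mono[OF N] by blast
  qed
  ultimately have "in_upper_bound (rk C) (nvars C) (cluster0 C) (matrix0 C) f"
    by (simp add: in_upper_bound_def)
  then have "f \<in> laurent_ring C (fst s)" if "s \<in> seeds C" for s
    using that laurent_seed_along by (force simp: seeds_def laurent_ring_eq seed_along_def)
  then show "f \<in> upper_cluster_algebra C"
    by (auto simp: upper_cluster_algebra_def case_prod_beta)
qed

end
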